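(* There exist a holomorphic semigroup $(\phi_t)$ in $\mathbb{D}$, not a group, a repelling fixed point $\sigma\in\partial\mathbb{D}$ of $(\phi_t)$, and a pre-model $(\mathbb{D},g,\eta_t)$ for $(\phi_t)$ at $\sigma$ such that $g$ is not regular at $\sigma$, i.e. the non-tangential limit $\angle\lim_{z\to\sigma}\frac{\sigma-g(z)}{\sigma-z}$ does not exist as a finite number.
   Context: $\mathbb{D}$ is the open unit disc in $\mathbb{C}$. A holomorphic semigroup in $\mathbb{D}$ is a family $(\phi_t)_{t\ge0}$ of holomorphic self-maps of $\mathbb{D}$ with $\phi_0=\mathrm{id}$, $\phi_{t+s}=\phi_t\circ\phi_s$, continuous in $t$ for uniform convergence on compacta. It is a group if $\phi_t$ is an automorphism of $\mathbb{D}$ for some (equivalently all) $t>0$. $\angle\lim$ denotes the non-tangential limit. $\sigma\in\partial\mathbb{D}$ is a repelling fixed point of $(\phi_t)$ with repelling spectral value $\lambda\in(-\infty,0)$ if $\angle\lim_{z\to\sigma}\phi_t(z)=\sigma$ and $\angle\lim_{z\to\sigma}\phi_t'(z)=e^{-\lambda t}$ for all $t\ge0$. Let $(\phi_t)$ be a semigroup, not a group, with a repelling fixed point $\sigma$ of repelling spectral value $\lambda$. A pre-model for $(\phi_t)$ at $\sigma$ is a triple $(\mathbb{D},g,\eta_t)$ such that: (i) $(\eta_t)$ is the unique hyperbolic group of automorphisms of $\mathbb{D}$ with Denjoy-Wolff point $-\sigma$, other fixed point $\sigma$, and spectral value $-\lambda$ (i.e. $\eta_t'(-\sigma)=e^{\lambda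 t}$, $\eta_t'(\sigma)=e^{-\lambda t}$, $\eta_t\to-\sigma$ as $t\to+\infty$); (ii) $g:\mathbb{D}\to\mathbb{D}$ is univalent, $\angle\lim_{z\to\sigma}g(z)=\sigma$, and $g$ is semi-conformal at $\sigma$, i.e. $\angle\lim_{z\to\sigma}\mathrm{Arg}\frac{1-\overline{\sigma}g(z)}{1-\overline{\sigma}z}=0$; (iii) $g\circ\eta_t=\phi_t\circ g$ for all $t\ge0$. *)

theory Defs
  imports "HOL-Analysis.Analysis"
begin

abbreviation unit_disc :: "complex set"
  where "unit_disc \<equiv> ball 0 1"

subsection \<open>Non-tangential limits at boundary points of the unit disc\<close>

definition stolz_region :: "complex \<Rightarrow> real \<Rightarrow> complex set"
  where "stolz_region \<sigma> M = {z \<in> unit_disc. norm (\<sigma> - z) < M * (1 - norm z)}"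

text \<open>
  Meaningful for \<open>norm \<sigma> = 1\<close>. In that case the region \<open>stolz_region \<sigma> M\<close> is empty for \<open>M \<le> 1\<close>
  and accumulates at \<open>\<sigma>\<close> for \<open>M > 1\<close>.
\<close>
definition nontangential_limit ::
    "(complex \<Rightarrow> 'a::topological_space) \<Rightarrow> complex \<Rightarrow> 'a \<Rightarrow> bool"
  where "nontangential_limit f \<sigma> L \<longleftrightarrow>
    (\<forall>M>1. (f \<longlongrightarrow> L) (at \<sigma> within stolz_region \<sigma> M))"

subsection \<open>Holomorphic semigroups in the unit disc\<close>

text \<open>
  Families are total functions of a real parameter and a complex variable; only their values for
  \<open>t \<ge> 0\<close> on the unit disc matter. In particular, values and derivatives at boundary
  points are always expressed through non-tangential limits.
\<close>

definition disc_automorphism :: "(complex \<Rightarrow> complex) \<Rightarrow> bool"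
  where "disc_automorphism f \<longleftrightarrow> f holomorphic_on unit_disc \<and> bij_betw f unit_disc unit_disc"

definition holomorphic_semigroup :: "(real \<Rightarrow> complex \<Rightarrow> complex) \<Rightarrow> bool"
  where "holomorphic_semigroup \<phi> \<longleftrightarrow>
    (\<forall>t\<ge>0. \<phi> t holomorphic_on unit_disc \<and> \<phi> t \<in> unit_disc \<rightarrow> unit_disc) \<and>
    (\<forall>z\<in>unit_disc. \<phi> 0 z = z) \<and>
    (\<forall>t\<ge>0. \<forall>s\<ge>0. \<forall>z\<in>unit_disc. \<phi> (t + s) z = \<phi> t (\<phi> s z)) \<and>
    (\<forall>s\<ge>0. \<forall>K. compact K \<and> K \<subseteq> unit_disc \<longrightarrow>
       uniform_limit K \<phi> (\<phi> s) (at s within {0..}))"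

definition holomorphic_group :: "(real \<Rightarrow> complex \<Rightarrow> complex) \<Rightarrow> bool"
  where "holomorphic_group \<phi> \<longleftrightarrow>
    holomorphic_semigroup \<phi> \<and> (\<exists>t>0. disc_automorphism (\<phi> t))"

definition repelling_fixed_point ::
    "(real \<Rightarrow> complex \<Rightarrow> complex) \<Rightarrow> complex \<Rightarrow> real \<Rightarrow> bool"
  where "repelling_fixed_point \<phi> \<sigma> lam \<longleftrightarrow>
    norm \<sigma> = 1 \<and> lam < 0 \<and>
    (\<forall>t\<ge>0. nontangential_limit (\<phi> t) \<sigma> \<sigma> \<and>
           nontangential_limit (deriv (\<phi> t)) \<sigma> (of_real (exp (- lam * t))))"

subsection \<open>Pre-models\<close>

text \<open>
  Hyperbolic group with Denjoy--Wolff point \<open>\<tau>\<close>, other fixed point \<open>\<sigma>\<close> and spectral value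
  \<open>\<mu> > 0\<close>; these data determine \<open>\<eta> t\<close> on the disc for all \<open>t \<ge> 0\<close>.
\<close>
definition hyperbolic_group ::
    "(real \<Rightarrow> complex \<Rightarrow> complex) \<Rightarrow> complex \<Rightarrow> complex \<Rightarrow> real \<Rightarrow> bool"
  where "hyperbolic_group \<eta> \<tau> \<sigma> \<mu> \<longleftrightarrow>
    holomorphic_semigroup \<eta> \<and> (\<forall>t\<ge>0. disc_automorphism (\<eta> t)) \<and>
    norm \<tau> = 1 \<and> norm \<sigma> = 1 \<and> \<tau> \<noteq> \<sigma> \<and> \<mu> > 0 \<and>
    (\<forall>t\<ge>0. nontangential_limit (\<eta> t) \<tau> \<tau> \<and>
           nontangential_limit (deriv (\<eta> t)) \<tau> (of_real (exp (- \<mu> * t))) \<and>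
           nontangential_limit (\<eta> t) \<sigma> \<sigma> \<and>
           nontangential_limit (deriv (\<eta> t)) \<sigma> (of_real (exp (\<mu> * t)))) \<and>
    (\<forall>K. compact K \<and> K \<subseteq> unit_disc \<longrightarrow> uniform_limit K \<eta> (\<lambda>_. \<tau>) at_top)"

definition semiconformal_at :: "(complex \<Rightarrow> complex) \<Rightarrow> complex \<Rightarrow> bool"
  where "semiconformal_at g \<sigma> \<longleftrightarrow>
    nontangential_limit (\<lambda>z. Arg ((1 - cnj \<sigma> * g z) / (1 - cnj \<sigma> * z))) \<sigma> 0"

definition pre_model ::
    "(real \<Rightarrow> complex \<Rightarrow> complex) \<Rightarrow> complex \<Rightarrow> real \<Rightarrow>
     (complex \<Rightarrow> complex) \<Rightarrow> (real \<Rightarrow> complex \<Rightarrow> complex) \<Rightarrow> bool"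
  where "pre_model \<phi> \<sigma> lam g \<eta> \<longleftrightarrow>
    hyperbolic_group \<eta> (- \<sigma>) \<sigma> (- lam) \<and>
    g holomorphic_on unit_disc \<and> g \<in> unit_disc \<rightarrow> unit_disc \<and> inj_on g unit_disc \<and>
    nontangential_limit g \<sigma> \<sigma> \<and> semiconformal_at g \<sigma> \<and>
    (\<forall>t\<ge>0. \<forall>z\<in>unit_disc. g (\<eta> t z) = \<phi> t (g z))"

definition regular_at :: "(complex \<Rightarrow> complex) \<Rightarrow> complex \<Rightarrow> bool"
  where "regular_at g \<sigma> \<longleftrightarrow>
    (\<exists>L. nontangential_limit (\<lambda>z. (\<sigma> - g z) / (\<sigma> - z)) \<sigma> L)"

end

theory Submission
  imports Defs "HOL-Complex_Analysis.Conformal_Mappings"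
begin

text \<open>
  In the strip \<open>\<bar>Im w\<bar> < pi / 2\<close>, with the boundary point \<open>\<sigma> = 1\<close> at its left end, take
  \<open>h w = w - Ln (Ln (1 + exp (- w)))\<close>. Since \<open>Re h' \<ge> 1\<close>, \<open>h\<close> is injective and its inverse is
  \<open>1\<close>-Lipschitz. The image of \<open>h\<close> contains the strip and is invariant under translation to the
  right, so \<open>\<phi> t = h\<inverse> \<circ> (h + t)\<close> is a semigroup, and \<open>g = h\<inverse>\<close> intertwines it with
  the translations \<open>\<eta> t\<close> of the strip. Near the left end \<open>h w - w\<close> is about \<open>- Ln (- w)\<close>: its
  imaginary part tends to \<open>0\<close>, which makes \<open>g\<close> semi-conformal, but its real part tends to
  \<open>-\<infinity>\<close>, so \<open>(1 - g z) / (1 - z)\<close> tends to infinity. In other words, the image of \<open>h\<close> narrows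
  to the strip too slowly for \<open>g\<close> to have an angular derivative.
\<close>

subsection \<open>Estimates for the logarithm\<close>

text \<open>The difference quotient is an average of \<open>f'\<close> over the segment from
  \<open>w\<close> to \<open>u\<close>, so it inherits every half-plane bound on \<open>f'\<close>.
  The factor \<open>c\<close> selects the half-plane.\<close>

lemma Re_difference_quotient_ge:
  fixes f f' :: "complex \<Rightarrow> complex"
  assumes "convex C"
    and deriv: "\<And>z. z \<in> C \<Longrightarrow> (f has_field_derivative f' z) (at z)"
    and bound: "\<And>z. z \<in> C \<Longrightarrow> b \<le> Re (c * f' z)"
    and "u \<in> C" "w \<in> C" "u \<noteq> w"
  shows "b \<le> Re (c * ((f u - f w) / (u - w)))"
proof -
  define \<gamma> where "\<gamma> s = w + of_real s * (u - w)" for s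
  have \<gamma>_in: "\<gamma> s \<in> C" if "0 \<le> s" "s \<le> 1" for s
  proof -
    have "\<gamma> s = (1 - s) *\<^sub>R w + s *\<^sub>R u"
      by (simp add: \<gamma>_def scaleR_conv_of_real algebra_simps)
    then show ?thesis
      using assms that by (simp add: convex_def)
  qed
  \<comment> \<open>Division by \<open>u - w\<close> cancels the chain rule factor, so the mean
    value theorem for the real function \<open>k\<close> gives the bound directly.\<close>
  define k where "k s = Re (c * (f (\<gamma> s) / (u - w)))" for s
  have k_deriv: "DERIV k s :> Re (c * f' (\<gamma> s))" if "0 \<le> s" "s \<le> 1" for s
  proof -
    have "(\<gamma> has_vector_derivative (u - w)) (at s)"
      unfolding \<gamma>_def by (auto intro!: derivative_eq_intros simp: has_vector_derivative_def scaleR_conv_of_real)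
    from field_vector_diff_chain_at[OF this deriv[OF \<gamma>_in[OF that]]]
    have "((f \<circ> \<gamma>) has_vector_derivative ((u - w) * f' (\<gamma> s))) (at s)" .
    then have "((\<lambda>s. (c / (u - w)) * (f \<circ> \<gamma>) s) has_vector_derivative
        (c / (u - w)) * ((u - w) * f' (\<gamma> s))) (at s)"
      by (intro has_vector_derivative_mult_right)
    from bounded_linear.has_vector_derivative[OF bounded_linear_Re this]
    show ?thesis
      using \<open>u \<noteq> w\<close> by (simp add: k_def[abs_def] has_real_derivative_iff_has_vector_derivative o_def)
  qed
  obtain s where s: "0 < s" "s < 1" "k 1 - k 0 = (1 - 0) * Re (c * f' (\<gamma> s))"
    using MVT2[of 0 1 k "\<lambda>s. Re (c * f' (\<gamma> s))"] k_deriv by auto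
  have "k 1 - k 0 = Re (c * ((f u - f w) / (u - w)))"
    by (simp add: k_def \<gamma>_def diff_divide_distrib right_diff_distrib)
  then show ?thesis
    using s bound[OF \<gamma>_in[of s]] by simp
qed

lemma norm_1_plus_ge:
  assumes "0 \<le> Re v"
  shows "1 \<le> cmod (1 + v)" "cmod v \<le> cmod (1 + v)" "v \<noteq> 0 \<Longrightarrow> 1 < cmod (1 + v)" "1 + v \<noteq> 0"
proof -
  have eq: "(cmod (1 + v))\<^sup>2 = 1 + 2 * Re v + (cmod v)\<^sup>2"
    by (simp add: cmod_power2) (simp add: power2_eq_square algebra_simps)
  then have "1\<^sup>2 \<le> (cmod (1 + v))\<^sup>2" and "(cmod v)\<^sup>2 \<le> (cmod (1 + v))\<^sup>2"
    using assms by simp_all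
  then show "1 \<le> cmod (1 + v)" "cmod v \<le> cmod (1 + v)"
    using power2_le_imp_le norm_ge_zero by blast+
  show "1 + v \<noteq> 0"
    using \<open>1 \<le> cmod (1 + v)\<close> by auto
  show "1 < cmod (1 + v)" if "v \<noteq> 0"
  proof -
    have "1\<^sup>2 < (cmod (1 + v))\<^sup>2"
      using eq assms that by (simp add: add_nonneg_pos)
    then show ?thesis
      by (rule power2_less_imp_less) simp
  qed
qed

lemma one_plus_notin_nonpos_Reals:
  assumes "0 \<le> Re v"
  shows "1 + v \<notin> \<real>\<^sub>\<le>\<^sub>0"
  using assms by (auto simp: complex_nonpos_Reals_iff)

lemma Re_Ln_1_plus_pos:
  assumes "0 \<le> Re v" "v \<noteq> 0"
  shows "0 < Re (Ln (1 + v))"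
  using norm_1_plus_ge[OF assms(1)] assms(2) by simp

lemma abs_Im_Ln_1_plus:
  assumes "0 \<le> Re v"
  shows "\<bar>Im (Ln (1 + v))\<bar> < pi / 2"
  using Re_Ln_pos_lt[of "1 + v"] norm_1_plus_ge(4)[OF assms] assms by simp

lemma norm_Ln_1_plus_le:
  assumes "0 \<le> Re v"
  shows "cmod (Ln (1 + v)) \<le> cmod v"
proof -
  have "cmod (Ln (1 + v) - Ln (1 + 0)) \<le> 1 * cmod (v - 0)"
  proof (rule field_differentiable_bound[where S = "{z. 0 \<le> Re z}" and f' = "\<lambda>z. 1 / (1 + z)"])
    show "convex {z. 0 \<le> Re z}"
      by (rule convex_halfspace_Re_ge)
    show "((\<lambda>z. Ln (1 + z)) has_field_derivative 1 / (1 + z)) (at z within {z. 0 \<le> Re z})"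
      if "z \<in> {z. 0 \<le> Re z}" for z
      using that one_plus_notin_nonpos_Reals[of z]
      by (auto intro!: derivative_eq_intros simp: divide_simps)
    show "cmod (1 / (1 + z)) \<le> 1" if "z \<in> {z. 0 \<le> Re z}" for z
      using that norm_1_plus_ge[of z] by (simp add: norm_divide divide_simps)
  qed (use assms in auto)
  then show ?thesis
    by simp
qed

text \<open>On the segment from \<open>0\<close> to \<open>v\<close> the integrand \<open>(1 + v) / (1 + s v)\<close> of the quantity below
  lies in the right half-plane, and in the lower half-plane if \<open>v\<close> does.\<close>

lemma Ln_quotient_quadrant:
  assumes v: "0 \<le> Re v" "v \<noteq> 0"
  shows "0 \<le> Re ((1 + v) * Ln (1 + v) / v)"
    and "Im v \<le> 0 \<Longrightarrow> Im ((1 + v) * Ln (1 + v) / v) \<le> 0"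
proof -
  have seg: "\<exists>s. 0 \<le> s \<and> s \<le> 1 \<and> z = of_real s * v" if "z \<in> closed_segment 0 v" for z
    using that by (auto simp: in_segment scaleR_conv_of_real)
  have seg_Re: "0 \<le> Re z" if z: "z \<in> closed_segment 0 v" for z
    using seg[OF z] v by auto
  have deriv: "((\<lambda>z. Ln (1 + z)) has_field_derivative 1 / (1 + z)) (at z)"
    if z: "z \<in> closed_segment 0 v" for z
    using one_plus_notin_nonpos_Reals[OF seg_Re[OF z]]
    by (auto intro!: derivative_eq_intros simp: divide_simps)
  \<comment> \<open>Rationalising the denominator leaves the signs of the real and imaginary parts
    to \<open>(1 + v) * cnj (1 + z)\<close>.\<close>
  have quot: "(1 + v) * (1 / (1 + z)) =
      (1 + v) * cnj (1 + z) / of_real ((cmod (1 + z))\<^sup>2)" if "z \<in> closed_segment 0 v" for z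
    using complex_div_cnj[of "1 + v" "1 + z"] by (metis mult.right_neutral times_divide_eq_right)
  have "0 \<le> Re ((1 + v) * (1 / (1 + z)))" if z: "z \<in> closed_segment 0 v" for z
  proof -
    obtain s where s: "0 \<le> s" "s \<le> 1" "z = of_real s * v"
      using seg[OF z] by blast
    have "Re ((1 + v) * cnj (1 + z)) = 1 + (1 + s) * Re v + s * (cmod v)\<^sup>2"
      unfolding cmod_power2 by (simp add: s algebra_simps power2_eq_square)
    also have "0 \<le> \<dots>"
      using s v by simp
    finally show ?thesis
      unfolding quot[OF z] Re_divide_of_real by simp
  qed
  from Re_difference_quotient_ge[OF convex_closed_segment[of 0 v] deriv this, of v 0] v
  show "0 \<le> Re ((1 + v) * Ln (1 + v) / v)"
    by simp
  \<comment> \<open>Multiplication by \<open>\<i>\<close> turns an upper bound for the imaginary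
    part into a lower bound for the real part.\<close>
  have "0 \<le> Re (\<i> * (1 + v) * (1 / (1 + z)))"
    if "Im v \<le> 0" and z: "z \<in> closed_segment 0 v" for z
  proof -
    obtain s where s: "0 \<le> s" "s \<le> 1" "z = of_real s * v"
      using seg[OF z] by blast
    have "Im ((1 + v) * cnj (1 + z)) = (1 - s) * Im v"
      by (simp add: s algebra_simps)
    also have "\<dots> \<le> 0"
      using s \<open>Im v \<le> 0\<close> by (simp add: mult_nonneg_nonpos)
    finally have "Im ((1 + v) * (1 / (1 + z))) \<le> 0"
      unfolding quot[OF z] Im_divide_of_real by (simp add: divide_nonpos_nonneg)
    then show ?thesis
      by (simp add: mult.assoc flip: times_divide_eq_right)
  qed
  from Re_difference_quotient_ge[OF convex_closed_segment[of 0 v] deriv this, of v 0] v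
  show "Im ((1 + v) * Ln (1 + v) / v) \<le> 0" if "Im v \<le> 0"
    using that by (simp add: mult.assoc flip: times_divide_eq_right)
qed

subsection \<open>The Koenigs function on the strip\<close>

definition strip :: "complex set"
  where "strip = {w. \<bar>Im w\<bar> < pi / 2}"

text \<open>The Koenigs function is analytic at the edges too, and estimates valid up to the edges
  are what locate the frontier of its image.\<close>

definition closed_strip :: "complex set"
  where "closed_strip = {w. \<bar>Im w\<bar> \<le> pi / 2}"

lemma strip_subset_closed_strip: "strip \<subseteq> closed_strip"
  by (auto simp: strip_def closed_strip_def)

lemma strip_conv: "strip = {w. Im w < pi / 2} \<inter> {w. - (pi / 2) < Im w}"
  by (auto simp: strip_def)

lemma closed_strip_conv: "closed_strip = {w. Im w \<le> pi / 2} \<inter> {w. - (pi / 2) \<le> Im w}"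
  by (auto simp: closed_strip_def)

lemma open_strip: "open strip"
  unfolding strip_conv by (intro open_Int open_halfspace_Im_lt open_halfspace_Im_gt)

lemma convex_strip: "convex strip"
  unfolding strip_conv using convex_halfspace_Im_lt convex_halfspace_Im_gt by (blast intro: convex_Int)

lemma closed_closed_strip: "closed closed_strip"
  unfolding closed_strip_conv by (intro closed_Int closed_halfspace_Im_le closed_halfspace_Im_ge)

lemma convex_closed_strip: "convex closed_strip"
  unfolding closed_strip_conv using convex_halfspace_Im_le convex_halfspace_Im_ge by (blast intro: convex_Int)

lemma add_of_real_mem_strip [simp]: "w + of_real t \<in> strip \<longleftrightarrow> w \<in> strip"
  by (simp add: strip_def)

text \<open>The inner logarithm stands in for \<open>- w\<close>: it is asymptotic to it at the left
  end, but has positive real part on the whole closed strip, so the outer logarithm meets no branch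
  cut.\<close>

definition koenigs :: "complex \<Rightarrow> complex"
  where "koenigs w = w - Ln (Ln (1 + exp (- w)))"

definition koenigs' :: "complex \<Rightarrow> complex"
  where "koenigs' w = 1 + exp (- w) / ((1 + exp (- w)) * Ln (1 + exp (- w)))"

lemma Re_exp_minus_nonneg:
  assumes "w \<in> closed_strip"
  shows "0 \<le> Re (exp (- w))"
  using assms cos_ge_zero[of "Im w"] by (auto simp: Re_exp closed_strip_def abs_le_iff)

lemma Re_Ln_1_plus_exp_pos:
  assumes "w \<in> closed_strip"
  shows "0 < Re (Ln (1 + exp (- w)))"
  using Re_Ln_1_plus_pos[OF Re_exp_minus_nonneg[OF assms]] by simp

lemma Re_Ln_1_plus_exp_ge:
  assumes "w \<in> closed_strip"
  shows "- Re w \<le> Re (Ln (1 + exp (- w)))"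
proof -
  note v = norm_1_plus_ge[OF Re_exp_minus_nonneg[OF assms]]
  have "- Re w = ln (cmod (exp (- w)))"
    by simp
  also have "\<dots> \<le> ln (cmod (1 + exp (- w)))"
    using v by (subst ln_le_cancel_iff) auto
  finally show ?thesis
    using v by simp
qed

lemma DERIV_koenigs:
  assumes "w \<in> closed_strip"
  shows "(koenigs has_field_derivative koenigs' w) (at w)"
proof -
  note v = Re_exp_minus_nonneg[OF assms]
  have "Ln (1 + exp (- w)) \<notin> \<real>\<^sub>\<le>\<^sub>0"
    using Re_Ln_1_plus_exp_pos[OF assms] by (auto simp: complex_nonpos_Reals_iff)
  with one_plus_notin_nonpos_Reals[OF v] show ?thesis
    unfolding koenigs_def[abs_def] koenigs'_def
    by (auto intro!: derivative_eq_intros simp: divide_simps)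
qed

text \<open>This exhibits \<open>koenigs' w - 1\<close> as the reciprocal of the quantity in
  \<open>Ln_quotient_quadrant\<close>, with \<open>v = exp (- w)\<close>. Reciprocals keep the sign
  of the real part and reverse that of the imaginary part.\<close>

lemma koenigs'_conv:
  "koenigs' w = 1 + inverse ((1 + exp (- w)) * Ln (1 + exp (- w)) / exp (- w))"
  by (simp add: koenigs'_def)

lemma Re_koenigs'_ge:
  assumes "w \<in> closed_strip"
  shows "1 \<le> Re (koenigs' w)"
  using Ln_quotient_quadrant(1)[OF Re_exp_minus_nonneg[OF assms]]
  unfolding koenigs'_conv by (simp del: inverse_divide)

lemma Im_koenigs'_nonneg:
  assumes "w \<in> closed_strip" "0 \<le> Im w"
  shows "0 \<le> Im (koenigs' w)"
proof -
  have "0 \<le> sin (Im w)"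
    using assms by (intro sin_ge_zero) (auto simp: closed_strip_def)
  then have "Im (exp (- w)) \<le> 0"
    by (simp add: Im_exp)
  then show ?thesis
    using Ln_quotient_quadrant(2)[OF Re_exp_minus_nonneg[OF assms(1)]]
    unfolding koenigs'_conv by (simp add: divide_nonpos_nonneg del: inverse_divide)
qed

lemma Re_koenigs_quotient_ge:
  assumes "u \<in> closed_strip" "w \<in> closed_strip" "u \<noteq> w"
  shows "1 \<le> Re ((koenigs u - koenigs w) / (u - w))"
  using Re_difference_quotient_ge[OF convex_closed_strip DERIV_koenigs, where c = 1, OF _ _ assms]
    Re_koenigs'_ge by simp

lemma Im_koenigs_quotient_nonneg:
  assumes "u \<in> closed_strip" "w \<in> closed_strip" "u \<noteq> w" "0 \<le> Im u" "0 \<le> Im w"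
  shows "0 \<le> Im ((koenigs u - koenigs w) / (u - w))"
proof -
  have "convex (closed_strip \<inter> {z. 0 \<le> Im z})"
    by (intro convex_Int convex_closed_strip convex_halfspace_Im_ge)
  from Re_difference_quotient_ge[OF this DERIV_koenigs, where c = "- \<i>" and b = 0 and u = u and w = w]
  have "0 \<le> Re (- \<i> * ((koenigs u - koenigs w) / (u - w)))"
    using assms Im_koenigs'_nonneg by auto
  moreover have "Re (- \<i> * z) = Im z" for z
    by simp
  ultimately show ?thesis
    by metis
qed

text \<open>A quotient with real part at least 1 has modulus at least 1. Injectivity, closedness of
  the image and the Lipschitz bounds for the inverse and the flow all rest on this.\<close>

lemma dist_le_dist_koenigs:
  assumes "u \<in> closed_strip" "w \<in> closed_strip"
  shows "cmod (u - w) \<le> cmod (koenigs u - koenigs w)"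
proof (cases "u = w")
  case False
  have "1 \<le> cmod ((koenigs u - koenigs w) / (u - w))"
    using Re_koenigs_quotient_ge[OF assms False] complex_Re_le_cmod order_trans by blast
  with False show ?thesis
    by (simp add: norm_divide divide_simps)
qed simp

lemma inj_on_koenigs: "inj_on koenigs closed_strip"
  using dist_le_dist_koenigs by (fastforce intro: inj_onI)

lemma holomorphic_koenigs: "koenigs holomorphic_on strip"
  using DERIV_koenigs strip_subset_closed_strip
  by (auto simp: holomorphic_on_open[OF open_strip])

text \<open>Since \<open>koenigs\<close> does not shrink distances, preimages of a convergent
  sequence form a Cauchy sequence, whose limit stays in the closed strip.\<close>

lemma closed_koenigs_image: "closed (koenigs ` closed_strip)"
  unfolding closed_sequential_limits
proof (intro allI impI)
  fix y l
  assume "(\<forall>n. y n \<in> koenigs ` closed_strip) \<and> y \<longlonglongrightarrow> l"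
  then obtain w where w: "\<And>n. w n \<in> closed_strip" "\<And>n. y n = koenigs (w n)" and y: "y \<longlonglongrightarrow> l"
    by (simp add: image_iff Bex_def) metis
  have "Cauchy y"
    using y by (rule LIMSEQ_imp_Cauchy)
  then have "Cauchy w"
    unfolding Cauchy_def dist_norm w(2)
    using dist_le_dist_koenigs[OF w(1) w(1)] by (meson order_le_less_trans)
  then obtain a where a: "w \<longlonglongrightarrow> a"
    by (auto simp: Cauchy_convergent_iff convergent_def)
  then have "a \<in> closed_strip"
    using closed_sequentially[OF closed_closed_strip] w(1) by blast
  then have "isCont koenigs a"
    using DERIV_koenigs DERIV_isCont by blast
  then have "y \<longlonglongrightarrow> koenigs a"
    using isCont_tendsto_compose[OF _ a] w(2) by (simp add: w(2)[abs_def])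
  then show "l \<in> koenigs ` closed_strip"
    using y LIMSEQ_unique \<open>a \<in> closed_strip\<close> by blast
qed

section \<open>The image of the Koenigs function and its invariance under translation to the
  right\<close>

definition koenigs_domain :: "complex set"
  where "koenigs_domain = koenigs ` strip"

lemma open_koenigs_domain: "open koenigs_domain"
  unfolding koenigs_domain_def
  using open_mapping_thm3[OF holomorphic_koenigs open_strip]
    inj_on_subset[OF inj_on_koenigs strip_subset_closed_strip] by blast

text \<open>The image of the strip is open and its closure stays in the closed image of the closed
  strip, so only edge points can produce frontier points.\<close>

lemma frontier_koenigs_domain: "frontier koenigs_domain \<subseteq> koenigs ` (closed_strip - strip)"
proof -
  have "closure koenigs_domain \<subseteq> koenigs ` closed_strip"
    unfolding koenigs_domain_def
    by (intro closure_minimal image_mono strip_subset_closed_strip closed_koenigs_image)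
  then show ?thesis
    using open_koenigs_domain by (auto simp: frontier_def interior_open koenigs_domain_def)
qed

lemma Im_Ln_nonpos:
  assumes "0 < Re z" "Im z \<le> 0"
  shows "Im (Ln z) \<le> 0"
proof -
  have "z \<noteq> 0"
    using assms by auto
  with assms have "\<bar>Im (Ln z)\<bar> < pi / 2"
    using Re_Ln_pos_lt by blast
  then show ?thesis
    using Im_Ln_pos_lt[OF \<open>z \<noteq> 0\<close>] assms pi_gt_zero by argo
qed

lemma Im_Ln_neg:
  assumes "0 < Re z" "Im z < 0"
  shows "Im (Ln z) < 0"
proof -
  have "z \<noteq> 0"
    using assms by auto
  then show ?thesis
    using Im_Ln_pos_le[OF \<open>z \<noteq> 0\<close>] assms Im_Ln_nonpos[OF assms(1)] pi_gt_zero by argo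
qed

text \<open>For \<open>w\<close> in the upper half, \<open>1 + exp (- w)\<close> lies in the lower
  half-plane and both logarithms stay there; subtracting the result can only raise the imaginary
  part. In particular the edges are mapped outside the open strip.\<close>

lemma Im_koenigs_ge:
  assumes "w \<in> closed_strip" "0 \<le> Im w"
  shows "Im w \<le> Im (koenigs w)"
proof -
  have "0 \<le> sin (Im w)"
    using assms by (intro sin_ge_zero) (auto simp: closed_strip_def)
  moreover have "0 < Re (1 + exp (- w))"
    using Re_exp_minus_nonneg[OF assms(1)] by simp
  ultimately have "Im (Ln (1 + exp (- w))) \<le> 0"
    by (intro Im_Ln_nonpos) (simp_all add: Im_exp)
  then show ?thesis
    using Im_Ln_nonpos[OF Re_Ln_1_plus_exp_pos[OF assms(1)]] by (simp add: koenigs_def)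
qed

text \<open>The strict version, with \<open>sin (Im w) > 0\<close>, later puts points of the image
  outside the strip.\<close>

lemma Im_koenigs_gt:
  assumes "w \<in> closed_strip" "0 < Im w"
  shows "Im w < Im (koenigs w)"
proof -
  have "0 < sin (Im w)"
    using assms pi_gt_zero by (intro sin_gt_zero) (auto simp: closed_strip_def)
  moreover have "0 < Re (1 + exp (- w))"
    using Re_exp_minus_nonneg[OF assms(1)] by simp
  ultimately have "Im (Ln (1 + exp (- w))) < 0"
    by (intro Im_Ln_neg) (simp_all add: Im_exp)
  then show ?thesis
    using Im_Ln_neg[OF Re_Ln_1_plus_exp_pos[OF assms(1)]] by (simp add: koenigs_def)
qed

lemma cnj_mem_strip [simp]: "cnj w \<in> strip \<longleftrightarrow> w \<in> strip"
  by (simp add: strip_def)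

lemma cnj_mem_closed_strip [simp]: "cnj w \<in> closed_strip \<longleftrightarrow> w \<in> closed_strip"
  by (simp add: closed_strip_def)

lemma koenigs_cnj:
  assumes "w \<in> closed_strip"
  shows "koenigs (cnj w) = cnj (koenigs w)"
proof -
  have "Ln (1 + exp (- w)) \<notin> \<real>\<^sub>\<le>\<^sub>0"
    using Re_Ln_1_plus_exp_pos[OF assms] by (auto simp: complex_nonpos_Reals_iff)
  with one_plus_notin_nonpos_Reals[OF Re_exp_minus_nonneg[OF assms]] show ?thesis
    by (simp add: koenigs_def cnj_Ln exp_cnj)
qed

text \<open>On the upper edge \<open>koenigs\<close> has difference quotients with nonnegative imaginary part, so a
  horizontal ray starting in the domain cannot leave it there; the lower edge is symmetric.\<close>

lemma koenigs_add_neq_upper_edge: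
  assumes w: "w \<in> strip" and u: "u \<in> closed_strip" "Im u = pi / 2" and "0 \<le> t"
  shows "koenigs w + of_real t \<noteq> koenigs u"
proof
  assume eq: "koenigs w + of_real t = koenigs u"
  have w': "w \<in> closed_strip" and "u \<noteq> w"
    using w u strip_subset_closed_strip by (auto simp: strip_def)
  have "pi / 2 \<le> Im (koenigs u)"
    using Im_koenigs_ge[OF u(1)] u(2) by simp
  show False
  proof (cases "0 \<le> Im w")
    case True
    define A where "A = (koenigs u - koenigs w) / (u - w)"
    have A: "1 \<le> Re A" "0 \<le> Im A"
      unfolding A_def using u(2) pi_ge_zero
      by (intro Re_koenigs_quotient_ge Im_koenigs_quotient_nonneg u(1) w' \<open>u \<noteq> w\<close> True; linarith)+
    then have "A \<noteq> 0"
      by auto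
    moreover have "of_real t = koenigs u - koenigs w"
      using eq by (metis add_diff_cancel_left')
    then have "of_real t = A * (u - w)"
      using \<open>u \<noteq> w\<close> by (simp add: A_def)
    \<comment> \<open>As \<open>A\<close> lies in the closed first quadrant, \<open>t / A\<close>
      has nonpositive imaginary part, whereas \<open>u\<close> on the upper edge lies strictly above
      \<open>w\<close>.\<close>
    ultimately have "u - w = of_real t * inverse A"
      by (simp add: field_simps)
    then have "Im (u - w) \<le> 0"
      using A \<open>0 \<le> t\<close> by (simp add: divide_nonneg_nonneg)
    moreover have "0 < Im (u - w)"
      using w u by (simp add: strip_def)
    ultimately show False
      by simp
  next
    \<comment> \<open>By reflection, a point below the real axis has its image on or below that
      axis, and a real translation cannot lift it to the height of \<open>koenigs u\<close>.\<close>
    case False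
    then have "Im (koenigs w) \<le> 0"
      using Im_koenigs_ge[of "cnj w"] w' by (simp add: koenigs_cnj)
    with \<open>pi / 2 \<le> Im (koenigs u)\<close> show False
      using arg_cong[OF eq, of Im] pi_gt_zero by simp
  qed
qed

lemma koenigs_add_neq_edge:
  assumes w: "w \<in> strip" and u: "u \<in> closed_strip - strip" and "0 \<le> t"
  shows "koenigs w + of_real t \<noteq> koenigs u"
proof (cases "Im u = pi / 2")
  case True
  then show ?thesis
    using koenigs_add_neq_upper_edge assms by blast
next
  case False
  then have "Im (cnj u) = pi / 2"
    using u by (auto simp: closed_strip_def strip_def)
  then have "koenigs (cnj w) + of_real t \<noteq> koenigs (cnj u)"
    using assms by (intro koenigs_add_neq_upper_edge) auto
  then have "cnj (koenigs w + of_real t) \<noteq> cnj (koenigs u)"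
    using assms strip_subset_closed_strip by (auto simp: koenigs_cnj)
  then show ?thesis
    by metis
qed

text \<open>A horizontal segment that left the domain would meet its frontier, hence the image of an
  edge, which \<open>koenigs_add_neq_edge\<close> excludes.\<close>

lemma koenigs_domain_add:
  assumes "y \<in> koenigs_domain" "0 \<le> t"
  shows "y + of_real t \<in> koenigs_domain"
proof (rule ccontr)
  assume contra: "y + of_real t \<notin> koenigs_domain"
  define X where "X = (\<lambda>s. y + of_real s) ` {0..t}"
  have "connected X"
    unfolding X_def by (intro connected_continuous_image continuous_intros) auto
  moreover have "y \<in> X" "y + of_real t \<in> X"
    using \<open>0 \<le> t\<close> by (auto simp: X_def image_iff intro: bexI[of _ 0])
  ultimately have "X \<inter> frontier koenigs_domain \<noteq> {}"
    using assms contra by (intro connected_Int_frontier) auto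
  then obtain s where "0 \<le> s" "y + of_real s \<in> frontier koenigs_domain"
    by (auto simp: X_def)
  moreover from this obtain u where "u \<in> closed_strip - strip" "y + of_real s = koenigs u"
    using frontier_koenigs_domain by blast
  ultimately show False
    using assms koenigs_add_neq_edge by (auto simp: koenigs_domain_def)
qed

text \<open>The strip is connected and shares the real point \<open>koenigs 0\<close> with the
  domain. If it were not contained in the domain, it would contain the image of an edge point, whose
  imaginary part has modulus at least \<open>pi / 2\<close>.\<close>

lemma strip_subset_koenigs_domain: "strip \<subseteq> koenigs_domain"
proof (rule ccontr)
  assume contra: "\<not> strip \<subseteq> koenigs_domain"
  have "koenigs 0 \<in> koenigs_domain"
    by (simp add: koenigs_domain_def strip_def)
  moreover have "cnj (koenigs 0) = koenigs 0"
    using koenigs_cnj[of 0] by (simp add: closed_strip_def)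
  then have "koenigs 0 \<in> strip"
    by (simp add: strip_def complex_eq_iff)
  ultimately have "strip \<inter> frontier koenigs_domain \<noteq> {}"
    using contra convex_connected[OF convex_strip] by (intro connected_Int_frontier) auto
  then obtain u where u: "u \<in> closed_strip" "u \<notin> strip" "koenigs u \<in> strip"
    using frontier_koenigs_domain by auto
  then show False
    using Im_koenigs_ge[of u] Im_koenigs_ge[of "cnj u"] koenigs_cnj[of u]
    by (auto simp: strip_def closed_strip_def abs_if split: if_splits)
qed

text \<open>The edge point \<open>\<i> * pi / 2\<close> is mapped strictly above the strip; by
  continuity so are nearby interior points.\<close>

lemma exists_koenigs_domain_not_strip:
  obtains y where "y \<in> koenigs_domain" "pi / 2 < Im y"
proof -
  define w where "w n = \<i> * of_real (pi / 2 - inverse (real (Suc n)))" for n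
  have "isCont koenigs (\<i> * of_real (pi / 2))"
    by (intro DERIV_isCont[OF DERIV_koenigs]) (simp add: closed_strip_def)
  moreover have "w \<longlonglongrightarrow> \<i> * of_real (pi / 2 - 0)"
    unfolding w_def by (intro tendsto_intros LIMSEQ_inverse_real_of_nat)
  ultimately have "(\<lambda>n. Im (koenigs (w n))) \<longlonglongrightarrow> Im (koenigs (\<i> * of_real (pi / 2)))"
    by (intro tendsto_Im isCont_tendsto_compose[of _ koenigs]) auto
  moreover have "pi / 2 < Im (koenigs (\<i> * of_real (pi / 2)))"
    using Im_koenigs_gt[of "\<i> * of_real (pi / 2)"] by (simp add: closed_strip_def)
  ultimately have "\<forall>\<^sub>F n in sequentially. pi / 2 < Im (koenigs (w n))"
    by (rule order_tendstoD)
  then obtain n where n: "pi / 2 < Im (koenigs (w n))"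
    by (auto simp: eventually_sequentially)
  have "inverse (real (Suc n)) \<le> 1" "0 < inverse (real (Suc n))"
    by (simp_all add: inverse_le_1_iff)
  moreover have "Im (w n) = pi / 2 - inverse (real (Suc n))"
    by (simp only: w_def Im_i_times Re_complex_of_real)
  moreover have "1 < pi / 2"
    using pi_gt3 by simp
  ultimately have "\<bar>Im (w n)\<bar> < pi / 2"
    by linarith
  then have "w n \<in> strip"
    by (simp add: strip_def)
  with n that show thesis
    by (auto simp: koenigs_domain_def)
qed

section \<open>Asymptotics of the Koenigs function at the left end\<close>

lemma abs_Im_koenigs_diff_le:
  assumes "w \<in> closed_strip" "Re w < 0"
  shows "\<bar>Im (koenigs w - w)\<bar> \<le> pi / 2 / (- Re w)"
proof -
  define x where "x = Ln (1 + exp (- w))"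
  have x: "- Re w \<le> Re x" "\<bar>Im x\<bar> < pi / 2"
    unfolding x_def using Re_Ln_1_plus_exp_ge abs_Im_Ln_1_plus Re_exp_minus_nonneg assms by auto
  then have "0 < Re x" "x \<noteq> 0"
    using assms by auto
  \<comment> \<open>The argument of \<open>x\<close> is small because \<open>Im x\<close> stays
    bounded while \<open>Re x\<close> is at least \<open>- Re w\<close>.\<close>
  then have "Im (Ln x) = arctan (Im x / Re x)"
    using Im_Ln_eq[of x] by simp
  moreover have "koenigs w - w = - Ln x"
    by (simp add: koenigs_def x_def)
  ultimately have "\<bar>Im (koenigs w - w)\<bar> = \<bar>arctan (Im x / Re x)\<bar>"
    by simp
  also have "\<dots> \<le> \<bar>Im x / Re x\<bar>"
    by (rule abs_arctan_le)
  also have "\<dots> \<le> pi / 2 / (- Re w)"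
    using x \<open>0 < Re x\<close> assms by (simp only: abs_divide) (intro frac_le; simp)
  finally show ?thesis .
qed

text \<open>This follows from \<open>norm_Ln_1_plus_le\<close>. The bound is crude, but it forces
  preimages of points far to the left to lie far to the left.\<close>

lemma Re_koenigs_ge:
  assumes "w \<in> closed_strip"
  shows "2 * Re w \<le> Re (koenigs w)"
proof -
  have "Ln (1 + exp (- w)) \<noteq> 0"
    using Re_Ln_1_plus_exp_pos[OF assms] by auto
  then have "ln (cmod (Ln (1 + exp (- w)))) \<le> ln (cmod (exp (- w)))"
    using norm_Ln_1_plus_le[OF Re_exp_minus_nonneg[OF assms]]
    by (subst ln_le_cancel_iff) auto
  then show ?thesis
    using \<open>Ln (1 + exp (- w)) \<noteq> 0\<close> by (simp add: koenigs_def)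
qed

lemma norm_koenigs'_diff_le:
  assumes "w \<in> closed_strip" "Re w < 0"
  shows "cmod (koenigs' w - 1) \<le> 1 / (- Re w)"
proof -
  note v = norm_1_plus_ge[OF Re_exp_minus_nonneg[OF assms(1)]]
  have "- Re w \<le> cmod (Ln (1 + exp (- w)))"
    using Re_Ln_1_plus_exp_ge[OF assms(1)] complex_Re_le_cmod order_trans by blast
  moreover have "cmod (exp (- w)) / cmod (1 + exp (- w)) \<le> 1"
    using v by (simp add: divide_simps)
  ultimately have "cmod (exp (- w)) / cmod (1 + exp (- w)) / cmod (Ln (1 + exp (- w))) \<le> 1 / (- Re w)"
    using assms(2) by (intro frac_le) auto
  then show ?thesis
    by (simp add: koenigs'_def norm_divide norm_mult)
qed

text \<open>The difference of \<open>koenigs\<close> and the identity has Lipschitz constant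
  \<open>1 / R\<close> where \<open>Re z \<le> - R\<close>. The extra margin \<open>t\<close> keeps
  \<open>u\<close> in that region, as \<open>u\<close> is within distance \<open>t\<close> of
  \<open>w\<close>.\<close>

lemma norm_koenigs_shift_le:
  assumes w: "w \<in> closed_strip" "Re w \<le> - R - t" and u: "u \<in> closed_strip" "koenigs u = koenigs w + of_real t"
    and "0 \<le> t" "0 < R"
  shows "cmod (u - w - of_real t) \<le> t / R"
proof -
  define C where "C = closed_strip \<inter> {z. Re z \<le> - R}"
  have dist: "cmod (u - w) \<le> t"
    using dist_le_dist_koenigs[OF u(1) w(1)] u(2) \<open>0 \<le> t\<close> by simp
  then have "Re u - Re w \<le> t"
    using complex_Re_le_cmod[of "u - w"] by simp
  then have "u \<in> C" "w \<in> C"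
    using u w \<open>0 \<le> t\<close> by (auto simp: C_def)
  have "cmod ((koenigs u - u) - (koenigs w - w)) \<le> 1 / R * cmod (u - w)"
  proof (rule field_differentiable_bound[where S = C and f' = "\<lambda>z. koenigs' z - 1"])
    show "convex C"
      unfolding C_def by (intro convex_Int convex_closed_strip convex_halfspace_Re_le)
    fix z assume "z \<in> C"
    then have z: "z \<in> closed_strip" "Re z \<le> - R"
      by (auto simp: C_def)
    show "((\<lambda>z. koenigs z - z) has_field_derivative koenigs' z - 1) (at z within C)"
      using DERIV_koenigs[OF z(1)]
      by (auto intro!: derivative_eq_intros intro: has_field_derivative_at_within)
    have "cmod (koenigs' z - 1) \<le> 1 / (- Re z)"
      using z \<open>0 < R\<close> by (intro norm_koenigs'_diff_le) auto
    also have "\<dots> \<le> 1 / R"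
      using z \<open>0 < R\<close> by (intro frac_le) auto
    finally show "cmod (koenigs' z - 1) \<le> 1 / R" .
  qed fact+
  also have "\<dots> \<le> t / R"
    using dist \<open>0 < R\<close> by (simp add: divide_simps)
  finally show ?thesis
    using u(2) by (simp add: norm_minus_commute algebra_simps)
qed

subsection \<open>The strip as a model of the disc\<close>

text \<open>This is \<open>- tanh (w / 2)\<close>. The left end of the strip corresponds to 1 and
  the right end to -1, so translation to the right moves points of the disc towards -1.\<close>

definition disc_of_strip :: "complex \<Rightarrow> complex"
  where "disc_of_strip w = (1 - exp w) / (1 + exp w)"

definition strip_of_disc :: "complex \<Rightarrow> complex"
  where "strip_of_disc z = Ln ((1 - z) / (1 + z))"

lemma Re_cayley_pos:
  assumes "z \<in> unit_disc"
  shows "0 < Re ((1 - z) / (1 + z))"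
proof -
  have "1 + z \<noteq> 0"
    using assms by (auto simp: add_eq_0_iff)
  moreover have "Re ((1 - z) * cnj (1 + z)) = 1 - (cmod z)\<^sup>2"
    unfolding cmod_power2 by (simp add: algebra_simps power2_eq_square)
  moreover have "(cmod z)\<^sup>2 < 1"
    using assms by (simp add: power_less_one_iff)
  ultimately show ?thesis
    unfolding complex_div_cnj[of "1 - z"] by (simp only: Re_divide_of_real flip: of_real_power) simp
qed

lemma Re_exp_strip_pos:
  assumes "w \<in> strip"
  shows "0 < Re (exp w)"
  using assms cos_gt_zero_pi[of "Im w"] by (auto simp: Re_exp strip_def abs_less_iff)

lemma one_plus_exp_neq_0:
  assumes "w \<in> strip"
  shows "1 + exp w \<noteq> 0"
  using Re_exp_strip_pos[OF assms] norm_1_plus_ge(4) by force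

lemma strip_of_disc_in:
  assumes "z \<in> unit_disc"
  shows "strip_of_disc z \<in> strip"
proof -
  have "(1 - z) / (1 + z) \<noteq> 0"
    using Re_cayley_pos[OF assms] by force
  then show ?thesis
    using Re_Ln_pos_lt Re_cayley_pos[OF assms] by (simp add: strip_of_disc_def strip_def)
qed

lemma disc_of_strip_in:
  assumes "w \<in> strip"
  shows "disc_of_strip w \<in> unit_disc"
proof -
  have "(cmod (1 - exp w))\<^sup>2 < (cmod (1 + exp w))\<^sup>2"
    unfolding cmod_power2 using Re_exp_strip_pos[OF assms] by (simp add: power2_eq_square algebra_simps)
  then have "cmod (1 - exp w) < cmod (1 + exp w)"
    by (rule power2_less_imp_less) simp
  then show ?thesis
    using one_plus_exp_neq_0[OF assms] by (simp add: disc_of_strip_def norm_divide divide_simps)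
qed

lemma exp_strip_of_disc:
  assumes "z \<in> unit_disc"
  shows "exp (strip_of_disc z) = (1 - z) / (1 + z)"
  unfolding strip_of_disc_def using Re_cayley_pos[OF assms] by (intro exp_Ln) force

lemma disc_of_strip_of_disc [simp]:
  assumes "z \<in> unit_disc"
  shows "disc_of_strip (strip_of_disc z) = z"
proof -
  have "1 + z \<noteq> 0"
    using assms by (auto simp: add_eq_0_iff)
  then show ?thesis
    unfolding disc_of_strip_def exp_strip_of_disc[OF assms] by (simp add: divide_simps)
qed

lemma strip_of_disc_of_strip [simp]:
  assumes "w \<in> strip"
  shows "strip_of_disc (disc_of_strip w) = w"
proof -
  have "(1 - disc_of_strip w) / (1 + disc_of_strip w) = exp w"
    using one_plus_exp_neq_0[OF assms] by (simp add: disc_of_strip_def divide_simps)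
  moreover have "- pi < Im w" "Im w \<le> pi"
    using assms pi_gt_zero by (auto simp: strip_def)
  ultimately show ?thesis
    by (simp add: strip_of_disc_def)
qed

definition disc_of_strip' :: "complex \<Rightarrow> complex"
  where "disc_of_strip' w = - 2 * exp w / (1 + exp w)\<^sup>2"

lemma DERIV_disc_of_strip:
  assumes "w \<in> strip"
  shows "(disc_of_strip has_field_derivative disc_of_strip' w) (at w)"
  unfolding disc_of_strip_def[abs_def] disc_of_strip'_def
  using one_plus_exp_neq_0[OF assms]
  by (auto intro!: derivative_eq_intros simp: divide_simps power2_eq_square)
    (simp add: algebra_simps)

lemma disc_of_strip'_neq_0:
  assumes "w \<in> strip"
  shows "disc_of_strip' w \<noteq> 0"
  using one_plus_exp_neq_0[OF assms] by (simp add: disc_of_strip'_def)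

lemma holomorphic_disc_of_strip: "disc_of_strip holomorphic_on strip"
  using DERIV_disc_of_strip by (auto simp: holomorphic_on_open[OF open_strip])

lemma DERIV_strip_of_disc:
  assumes "z \<in> unit_disc"
  shows "(strip_of_disc has_field_derivative inverse (disc_of_strip' (strip_of_disc z))) (at z)"
proof -
  define w where "w = strip_of_disc z"
  have w: "w \<in> strip"
    using strip_of_disc_in[OF assms] by (simp add: w_def)
  have "(strip_of_disc has_field_derivative inverse (disc_of_strip' w)) (at (disc_of_strip w))"
    using has_field_derivative_inverse_strong[OF DERIV_disc_of_strip[OF w] disc_of_strip'_neq_0[OF w]
        open_strip w holomorphic_on_imp_continuous_on[OF holomorphic_disc_of_strip]] by simp
  then show ?thesis
    using assms by (simp add: w_def)
qed

lemma holomorphic_strip_of_disc: "strip_of_disc holomorphic_on unit_disc"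
  using DERIV_strip_of_disc unfolding holomorphic_on_open[OF open_ball] by blast

text \<open>The derivative is at most 1 in modulus because \<open>2 * r \<le> 1 + r^2\<close> for
  \<open>r = cmod (exp w)\<close>, and \<open>Re (exp w) > 0\<close>. Bounds in time on the strip
  thus carry over to the disc.\<close>

lemma norm_disc_of_strip_diff_le:
  assumes "w \<in> strip" "u \<in> strip"
  shows "cmod (disc_of_strip w - disc_of_strip u) \<le> cmod (w - u)"
proof -
  have "cmod (disc_of_strip w - disc_of_strip u) \<le> 1 * cmod (w - u)"
  proof (rule field_differentiable_bound[OF convex_strip])
    fix w assume w: "w \<in> strip"
    show "(disc_of_strip has_field_derivative disc_of_strip' w) (at w within strip)"
      using DERIV_disc_of_strip[OF w] by (rule has_field_derivative_at_within)
    have "2 * cmod (exp w) \<le> 1 + (cmod (exp w))\<^sup>2"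
      using sum_squares_bound[of 1 "cmod (exp w)"] by simp
    also have "\<dots> \<le> (cmod (1 + exp w))\<^sup>2"
      unfolding cmod_power2 using Re_exp_strip_pos[OF w] by (simp add: power2_eq_square algebra_simps)
    finally show "cmod (disc_of_strip' w) \<le> 1"
      using one_plus_exp_neq_0[OF w]
      by (simp add: disc_of_strip'_def norm_divide norm_mult norm_power divide_simps del: norm_exp_eq_Re)
  qed (use assms in auto)
  then show ?thesis
    by simp
qed

lemma one_minus_disc_of_strip:
  assumes "w \<in> strip"
  shows "1 - disc_of_strip w = 2 * exp w / (1 + exp w)"
  using one_plus_exp_neq_0[OF assms] by (simp add: disc_of_strip_def divide_simps)

subsection \<open>The left end of the strip\<close>

text \<open>\<open>strip_of_disc\<close> maps the boundary point \<open>1\<close> to the left end of the strip.\<close>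

definition strip_end :: "complex filter"
  where "strip_end = inf (filtercomap Re at_bot) (principal strip)"

lemma filterlim_strip_end:
  "filterlim f strip_end F \<longleftrightarrow>
    filterlim (\<lambda>x. Re (f x)) at_bot F \<and> eventually (\<lambda>x. f x \<in> strip) F"
  by (simp add: strip_end_def filterlim_inf filterlim_filtercomap_iff filterlim_principal o_def)

lemma filterlim_Re_strip_end: "filterlim Re at_bot strip_end"
  and eventually_in_strip_end: "eventually (\<lambda>w. w \<in> strip) strip_end"
  using filterlim_ident[of strip_end] unfolding filterlim_strip_end by auto

lemma filterlim_minus_Re_strip_end: "filterlim (\<lambda>w. - Re w) at_top strip_end"
  using filterlim_Re_strip_end by (simp add: filterlim_uminus_at_bot)

lemma eventually_Re_less_strip_end: "eventually (\<lambda>w. Re w < r) strip_end"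
  using filterlim_Re_strip_end by (simp add: filterlim_at_bot_dense)

lemma tendsto_exp_strip_end: "(exp \<longlongrightarrow> 0) strip_end"
proof -
  have "((\<lambda>w. exp (Re w)) \<longlongrightarrow> 0) strip_end"
    by (rule filterlim_compose[OF exp_at_bot filterlim_Re_strip_end])
  then show ?thesis
    by (subst tendsto_norm_zero_iff[symmetric]) simp
qed

lemma tendsto_disc_of_strip: "(disc_of_strip \<longlongrightarrow> 1) strip_end"
proof -
  have "((\<lambda>w. (1 - exp w) / (1 + exp w)) \<longlongrightarrow> (1 - 0) / (1 + 0)) strip_end"
    by (intro tendsto_intros tendsto_exp_strip_end) simp
  then show ?thesis
    by (simp add: disc_of_strip_def[abs_def])
qed

lemma eventually_at_within_in: "eventually (\<lambda>z. z \<in> S) (at a within S)"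
  by (simp add: eventually_at_topological) blast

text \<open>The real part of \<open>strip_of_disc z\<close> is the logarithm of \<open>c z\<close>,
  which tends to 0 through positive values for any approach to 1 inside the disc.\<close>

lemma filterlim_strip_of_disc: "filterlim strip_of_disc strip_end (at 1 within unit_disc)"
  unfolding filterlim_strip_end
proof
  define c where "c z = cmod ((1 - z) / (1 + z))" for z :: complex
  have "((\<lambda>z. (1 - z) / (1 + z)) \<longlongrightarrow> (1 - 1) / (1 + 1)) (at (1 :: complex) within unit_disc)"
    by (intro tendsto_intros) simp
  then have "(c \<longlongrightarrow> 0) (at 1 within unit_disc)"
    unfolding c_def by (intro tendsto_norm_zero) simp
  moreover have "eventually (\<lambda>z. 0 < c z) (at 1 within unit_disc)"
    by (rule eventually_mono[OF eventually_at_within_in]) (use Re_cayley_pos in \<open>force simp: c_def\<close>)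
  ultimately have "filterlim c (at_right 0) (at 1 within unit_disc)"
    by (simp add: filterlim_at eventually_mono)
  then have "filterlim (\<lambda>z. ln (c z)) at_bot (at 1 within unit_disc)"
    by (rule filterlim_compose[OF ln_at_0])
  moreover have "eventually (\<lambda>z. ln (c z) = Re (strip_of_disc z)) (at 1 within unit_disc)"
  proof (rule eventually_mono[OF eventually_at_within_in])
    fix z :: complex assume "z \<in> unit_disc"
    then have "(1 - z) / (1 + z) \<noteq> 0"
      using Re_cayley_pos by force
    then show "ln (c z) = Re (strip_of_disc z)"
      by (simp add: c_def strip_of_disc_def)
  qed
  ultimately show "filterlim (\<lambda>z. Re (strip_of_disc z)) at_bot (at 1 within unit_disc)"
    using filterlim_cong by force
  show "eventually (\<lambda>z. strip_of_disc z \<in> strip) (at 1 within unit_disc)"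
    by (rule eventually_mono[OF eventually_at_within_in strip_of_disc_in])
qed

subsection \<open>The inverse of the Koenigs function\<close>

definition koenigs_inv :: "complex \<Rightarrow> complex"
  where "koenigs_inv = inv_into strip koenigs"

lemma koenigs_inv_in: "y \<in> koenigs_domain \<Longrightarrow> koenigs_inv y \<in> strip"
  and koenigs_koenigs_inv: "y \<in> koenigs_domain \<Longrightarrow> koenigs (koenigs_inv y) = y"
  by (auto simp: koenigs_inv_def koenigs_domain_def inv_into_into f_inv_into_f)

lemma koenigs_inv_koenigs: "w \<in> strip \<Longrightarrow> koenigs_inv (koenigs w) = w"
  unfolding koenigs_inv_def
  using inj_on_subset[OF inj_on_koenigs strip_subset_closed_strip] by (rule inv_into_f_f)

lemma koenigs_in_domain: "w \<in> strip \<Longrightarrow> koenigs w \<in> koenigs_domain"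
  by (simp add: koenigs_domain_def)

lemma norm_koenigs_inv_diff_le:
  assumes "x \<in> koenigs_domain" "y \<in> koenigs_domain"
  shows "cmod (koenigs_inv x - koenigs_inv y) \<le> cmod (x - y)"
  using dist_le_dist_koenigs[of "koenigs_inv x" "koenigs_inv y"] assms koenigs_inv_in
    strip_subset_closed_strip by (auto simp: koenigs_koenigs_inv)

lemma DERIV_koenigs_inv:
  assumes "y \<in> koenigs_domain"
  shows "(koenigs_inv has_field_derivative inverse (koenigs' (koenigs_inv y))) (at y)"
proof -
  define u where "u = koenigs_inv y"
  have u: "u \<in> strip" "u \<in> closed_strip"
    using koenigs_inv_in[OF assms] strip_subset_closed_strip by (auto simp: u_def)
  have "koenigs' u \<noteq> 0"
    using Re_koenigs'_ge[OF u(2)] by auto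
  then have "(koenigs_inv has_field_derivative inverse (koenigs' u)) (at (koenigs u))"
    using has_field_derivative_inverse_strong[OF DERIV_koenigs[OF u(2)] _ open_strip u(1)
        holomorphic_on_imp_continuous_on[OF holomorphic_koenigs]] koenigs_inv_koenigs by blast
  then show ?thesis
    using koenigs_koenigs_inv[OF assms] by (simp add: u_def)
qed

lemma holomorphic_koenigs_inv: "koenigs_inv holomorphic_on koenigs_domain"
  using DERIV_koenigs_inv by (auto simp: holomorphic_on_open[OF open_koenigs_domain])

lemma filterlim_koenigs_inv: "filterlim koenigs_inv strip_end strip_end"
  unfolding filterlim_strip_end
proof
  have in_strip: "eventually (\<lambda>w. koenigs_inv w \<in> strip) strip_end"
    by (rule eventually_mono[OF eventually_in_strip_end])
      (use koenigs_inv_in strip_subset_koenigs_domain in blast)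
  then show "eventually (\<lambda>w. koenigs_inv w \<in> strip) strip_end" .
  have "Re (koenigs_inv w) \<le> Re w / 2" if "w \<in> strip" for w
  proof -
    have "w \<in> koenigs_domain"
      using that strip_subset_koenigs_domain by blast
    then have "koenigs_inv w \<in> closed_strip" "koenigs (koenigs_inv w) = w"
      using koenigs_inv_in koenigs_koenigs_inv strip_subset_closed_strip by blast+
    then show ?thesis
      using Re_koenigs_ge[of "koenigs_inv w"] by simp
  qed
  then have "eventually (\<lambda>w. Re (koenigs_inv w) \<le> Re w / 2) strip_end"
    by (rule eventually_mono[OF eventually_in_strip_end])
  moreover have "filterlim (\<lambda>w. Re w / 2) at_bot strip_end"
    unfolding filterlim_at_bot_dense by (simp add: eventually_Re_less_strip_end)
  ultimately show "filterlim (\<lambda>w. Re (koenigs_inv w)) at_bot strip_end"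
    by (rule filterlim_at_bot_mono[rotated])
qed

subsection \<open>The flow on the strip\<close>

definition strip_flow :: "real \<Rightarrow> complex \<Rightarrow> complex"
  where "strip_flow t w = koenigs_inv (koenigs w + of_real t)"

context
  fixes w :: complex and t :: real
  assumes w: "w \<in> strip" and t: "0 \<le> t"
begin

lemma koenigs_add_in_domain: "koenigs w + of_real t \<in> koenigs_domain"
  using koenigs_in_domain[OF w] t by (rule koenigs_domain_add)

lemma strip_flow_in: "strip_flow t w \<in> strip"
  unfolding strip_flow_def using koenigs_add_in_domain by (rule koenigs_inv_in)

lemma koenigs_strip_flow: "koenigs (strip_flow t w) = koenigs w + of_real t"
  unfolding strip_flow_def using koenigs_add_in_domain by (rule koenigs_koenigs_inv)

lemma DERIV_strip_flow:
  "(strip_flow t has_field_derivative koenigs' w / koenigs' (strip_flow t w)) (at w)"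
proof -
  have "((\<lambda>w. koenigs w + of_real t) has_field_derivative koenigs' w) (at w)"
    using DERIV_koenigs w strip_subset_closed_strip by (auto intro!: derivative_eq_intros)
  from DERIV_chain2[OF DERIV_koenigs_inv[OF koenigs_add_in_domain] this]
  show ?thesis
    by (simp add: strip_flow_def[abs_def] field_simps)
qed

end

text \<open>The inverse Koenigs function is nonexpansive, so the flow has speed at most 1. This
  gives continuity in time and stops the flow from leaving the left end abruptly.\<close>

lemma norm_strip_flow_diff_le:
  assumes "w \<in> strip" "0 \<le> s" "0 \<le> t"
  shows "cmod (strip_flow t w - strip_flow s w) \<le> \<bar>t - s\<bar>"
  using norm_koenigs_inv_diff_le[OF koenigs_add_in_domain koenigs_add_in_domain, of w t w s] assms
  by (simp add: strip_flow_def flip: of_real_diff)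

lemma strip_flow_0: "w \<in> strip \<Longrightarrow> strip_flow 0 w = w"
  by (simp add: strip_flow_def koenigs_inv_koenigs)

lemma strip_flow_add:
  assumes "w \<in> strip" "0 \<le> s" "0 \<le> t"
  shows "strip_flow (t + s) w = strip_flow t (strip_flow s w)"
  using koenigs_strip_flow[OF assms(1,2)] by (simp add: strip_flow_def algebra_simps)

lemma filterlim_strip_flow:
  assumes "0 \<le> t"
  shows "filterlim (strip_flow t) strip_end strip_end"
  unfolding filterlim_strip_end
proof
  show "eventually (\<lambda>w. strip_flow t w \<in> strip) strip_end"
    using eventually_mono[OF eventually_in_strip_end strip_flow_in[OF _ assms]] .
  have "Re (strip_flow t w) \<le> Re w + t" if "w \<in> strip" for w
    using norm_strip_flow_diff_le[OF that order_refl assms] complex_Re_le_cmod[of "strip_flow t w - w"]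
      assms by (simp add: strip_flow_0 that)
  then have "eventually (\<lambda>w. Re (strip_flow t w) \<le> Re w + t) strip_end"
    by (rule eventually_mono[OF eventually_in_strip_end])
  moreover have "filterlim (\<lambda>w. Re w + t) at_bot strip_end"
    unfolding filterlim_at_bot_dense by (simp add: eventually_Re_less_strip_end flip: less_diff_eq)
  ultimately show "filterlim (\<lambda>w. Re (strip_flow t w)) at_bot strip_end"
    by (rule filterlim_at_bot_mono[rotated])
qed

lemma tendsto_strip_flow_diff:
  assumes "0 \<le> t"
  shows "((\<lambda>w. strip_flow t w - w) \<longlongrightarrow> of_real t) strip_end"
proof (rule tendstoI)
  fix e :: real assume "0 < e"
  \<comment> \<open>The summand 1 makes \<open>R\<close> positive even for \<open>t = 0\<close> and
    the inequality \<open>t / R < e\<close> strict.\<close>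
  define R where "R = (t + 1) / e"
  have "0 < R" "t / R < e"
    using \<open>0 < e\<close> assms by (auto simp: R_def field_simps)
  have "eventually (\<lambda>w. w \<in> strip \<and> Re w < - R - t) strip_end"
    by (intro eventually_conj eventually_in_strip_end eventually_Re_less_strip_end)
  then show "eventually (\<lambda>w. dist (strip_flow t w - w) (of_real t) < e) strip_end"
  proof (rule eventually_mono)
    fix w assume w: "w \<in> strip \<and> Re w < - R - t"
    then have "cmod (strip_flow t w - w - of_real t) \<le> t / R"
      using strip_flow_in[of w t] koenigs_strip_flow[of w t] assms \<open>0 < R\<close> strip_subset_closed_strip
      by (intro norm_koenigs_shift_le) auto
    with \<open>t / R < e\<close> show "dist (strip_flow t w - w) (of_real t) < e"
      by (simp add: dist_norm)
  qed
qed

lemma tendsto_divide_minus_Re_strip_end: "((\<lambda>w. c / (- Re w)) \<longlongrightarrow> (0 :: real)) strip_end"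
  by (intro tendsto_divide_0[OF tendsto_const] filterlim_at_top_imp_at_infinity
      filterlim_minus_Re_strip_end)

lemma tendsto_koenigs': "(koenigs' \<longlongrightarrow> 1) strip_end"
proof -
  have "eventually (\<lambda>w. w \<in> strip \<and> Re w < 0) strip_end"
    by (intro eventually_conj eventually_in_strip_end eventually_Re_less_strip_end)
  then have "eventually (\<lambda>w. cmod (koenigs' w - 1) \<le> 1 / (- Re w)) strip_end"
    by (rule eventually_mono) (use norm_koenigs'_diff_le strip_subset_closed_strip in blast)
  then show ?thesis
    by (intro LIM_zero_cancel[OF Lim_null_comparison[OF _ tendsto_divide_minus_Re_strip_end]])
qed

lemma tendsto_Im_koenigs_diff: "((\<lambda>w. Im (koenigs w - w)) \<longlongrightarrow> 0) strip_end"
proof -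
  have "eventually (\<lambda>w. w \<in> strip \<and> Re w < 0) strip_end"
    by (intro eventually_conj eventually_in_strip_end eventually_Re_less_strip_end)
  then have "eventually (\<lambda>w. norm (Im (koenigs w - w)) \<le> pi / 2 / (- Re w)) strip_end"
    by (rule eventually_mono) (use abs_Im_koenigs_diff_le strip_subset_closed_strip in auto)
  then show ?thesis
    by (rule Lim_null_comparison[OF _ tendsto_divide_minus_Re_strip_end])
qed

subsection \<open>Transport to the disc\<close>

text \<open>The boundary limits below are all obtained for unrestricted approach within the disc,
  which contains every Stolz region.\<close>

lemma nontangential_limitI:
  assumes "(f \<longlongrightarrow> L) (at \<sigma> within unit_disc)"
  shows "nontangential_limit f \<sigma> L"
  unfolding nontangential_limit_def
  by (auto intro: tendsto_within_subset[OF assms] simp: stolz_region_def)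

lemma tendsto_within_cong:
  assumes "(f \<longlongrightarrow> L) (at a within S)" "\<And>z. z \<in> S \<Longrightarrow> g z = f z"
  shows "(g \<longlongrightarrow> L) (at a within S)"
proof -
  have "eventually (\<lambda>z. f z = g z) (at a within S)"
    by (rule eventually_mono[OF eventually_at_within_in]) (simp add: assms(2))
  from tendsto_cong[OF this] assms(1) show ?thesis
    by blast
qed

text \<open>Shared by the flow and the translation group. The speed bound gives continuity in time
  uniformly over the disc, with the same \<open>e\<close> as threshold for time and
  distance.\<close>

lemma holomorphic_semigroup_strip:
  assumes hol: "\<And>t. 0 \<le> t \<Longrightarrow> \<psi> t holomorphic_on strip"
    and in_strip: "\<And>t w. 0 \<le> t \<Longrightarrow> w \<in> strip \<Longrightarrow> \<psi> t w \<in> strip"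
    and zero: "\<And>w. w \<in> strip \<Longrightarrow> \<psi> 0 w = w"
    and add: "\<And>s t w. 0 \<le> s \<Longrightarrow> 0 \<le> t \<Longrightarrow> w \<in> strip \<Longrightarrow> \<psi> (t + s) w = \<psi> t (\<psi> s w)"
    and lipschitz: "\<And>s t w. 0 \<le> s \<Longrightarrow> 0 \<le> t \<Longrightarrow> w \<in> strip \<Longrightarrow> cmod (\<psi> t w - \<psi> s w) \<le> \<bar>t - s\<bar>"
  shows "holomorphic_semigroup (\<lambda>t z. disc_of_strip (\<psi> t (strip_of_disc z)))"
  unfolding holomorphic_semigroup_def
proof (intro conjI allI impI ballI)
  fix t :: real assume t: "0 \<le> t"
  have "(\<psi> t \<circ> strip_of_disc) holomorphic_on unit_disc"
    using strip_of_disc_in by (intro holomorphic_on_compose_gen[OF holomorphic_strip_of_disc hol[OF t]]) blast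
  then have "(disc_of_strip \<circ> (\<psi> t \<circ> strip_of_disc)) holomorphic_on unit_disc"
    using strip_of_disc_in in_strip[OF t]
    by (intro holomorphic_on_compose_gen[OF _ holomorphic_disc_of_strip]) auto
  then show "(\<lambda>z. disc_of_strip (\<psi> t (strip_of_disc z))) holomorphic_on unit_disc"
    by (simp add: o_def)
  show "(\<lambda>z. disc_of_strip (\<psi> t (strip_of_disc z))) \<in> unit_disc \<rightarrow> unit_disc"
    using disc_of_strip_in in_strip[OF t] strip_of_disc_in by blast
next
  fix z assume "z \<in> unit_disc"
  then show "disc_of_strip (\<psi> 0 (strip_of_disc z)) = z"
    by (simp only: zero strip_of_disc_in disc_of_strip_of_disc)
next
  fix t s :: real and z assume "0 \<le> t" "0 \<le> s" "z \<in> unit_disc"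
  then show "disc_of_strip (\<psi> (t + s) (strip_of_disc z)) =
      disc_of_strip (\<psi> t (strip_of_disc (disc_of_strip (\<psi> s (strip_of_disc z)))))"
    by (simp only: add in_strip strip_of_disc_in strip_of_disc_of_strip)
next
  fix s :: real and K assume s: "0 \<le> s" and K: "compact K \<and> K \<subseteq> unit_disc"
  show "uniform_limit K (\<lambda>t z. disc_of_strip (\<psi> t (strip_of_disc z)))
      (\<lambda>z. disc_of_strip (\<psi> s (strip_of_disc z))) (at s within {0..})"
  proof (rule uniform_limitI)
    fix e :: real assume "0 < e"
    have "dist (disc_of_strip (\<psi> t (strip_of_disc z))) (disc_of_strip (\<psi> s (strip_of_disc z))) < e"
      if "0 \<le> t" "dist t s < e" "z \<in> K" for t z
    proof -
      have w: "strip_of_disc z \<in> strip"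
        using strip_of_disc_in K that by blast
      have "cmod (disc_of_strip (\<psi> t (strip_of_disc z)) - disc_of_strip (\<psi> s (strip_of_disc z))) \<le> \<bar>t - s\<bar>"
        using norm_disc_of_strip_diff_le[OF in_strip in_strip, OF that(1) w s w] lipschitz[OF s that(1) w]
        by (rule order_trans)
      with that show ?thesis
        by (simp add: dist_norm)
    qed
    with \<open>0 < e\<close> show "\<forall>\<^sub>F t in at s within {0..}. \<forall>z\<in>K. dist (disc_of_strip (\<psi> t (strip_of_disc z)))
        (disc_of_strip (\<psi> s (strip_of_disc z))) < e"
      unfolding eventually_at by (intro exI[of _ e]) auto
  qed
qed

text \<open>The derivative is factored so that its limit at the left end can be read off: both
  exponentials in the squared quotient vanish there, and the displacement of \<open>f\<close>
  determines the rest together with \<open>d\<close>.\<close>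

lemma DERIV_strip_conjugate:
  assumes z: "z \<in> unit_disc" and "f (strip_of_disc z) \<in> strip"
    and "(f has_field_derivative d) (at (strip_of_disc z))"
  shows "((\<lambda>z. disc_of_strip (f (strip_of_disc z))) has_field_derivative
    exp (f (strip_of_disc z) - strip_of_disc z) *
      ((1 + exp (strip_of_disc z)) / (1 + exp (f (strip_of_disc z))))\<^sup>2 * d) (at z)"
proof -
  define w where "w = strip_of_disc z"
  have w: "1 + exp w \<noteq> 0" "1 + exp (f w) \<noteq> 0"
    using one_plus_exp_neq_0 strip_of_disc_in[OF z] assms(2) by (auto simp: w_def)
  have "((\<lambda>z. disc_of_strip (f (strip_of_disc z))) has_field_derivative
      disc_of_strip' (f w) * (d * inverse (disc_of_strip' w))) (at z)"
    unfolding w_def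
    by (rule DERIV_chain2[where f = disc_of_strip, OF DERIV_disc_of_strip[OF assms(2)]
          DERIV_chain2[where f = f, OF assms(3) DERIV_strip_of_disc[OF z]]])
  also have "disc_of_strip' (f w) * (d * inverse (disc_of_strip' w)) =
      exp (f w - w) * ((1 + exp w) / (1 + exp (f w)))\<^sup>2 * d"
    using w by (simp add: disc_of_strip'_def exp_diff field_simps)
  finally show ?thesis
    by (simp add: w_def)
qed

lemma strip_conjugate_limits:
  assumes in_strip: "\<And>w. w \<in> strip \<Longrightarrow> f w \<in> strip"
    and deriv: "\<And>w. w \<in> strip \<Longrightarrow> (f has_field_derivative f' w) (at w)"
    and lim: "filterlim f strip_end strip_end" "((\<lambda>w. f w - w) \<longlongrightarrow> c) strip_end"
      "(f' \<longlongrightarrow> 1) strip_end"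
  shows "nontangential_limit (\<lambda>z. disc_of_strip (f (strip_of_disc z))) 1 1"
    and "nontangential_limit (deriv (\<lambda>z. disc_of_strip (f (strip_of_disc z)))) 1 (exp c)"
proof -
  have "((\<lambda>z. disc_of_strip (f (strip_of_disc z))) \<longlongrightarrow> 1) (at 1 within unit_disc)"
    by (intro filterlim_compose[OF tendsto_disc_of_strip] filterlim_compose[OF lim(1)]
        filterlim_strip_of_disc)
  then show "nontangential_limit (\<lambda>z. disc_of_strip (f (strip_of_disc z))) 1 1"
    by (rule nontangential_limitI)
  define D where "D w = exp (f w - w) * ((1 + exp w) / (1 + exp (f w)))\<^sup>2 * f' w" for w
  have "(D \<longlongrightarrow> exp c * ((1 + 0) / (1 + 0))\<^sup>2 * 1) strip_end"
    unfolding D_def using lim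
    by (intro tendsto_intros tendsto_exp_strip_end filterlim_compose[OF tendsto_exp_strip_end lim(1)]) auto
  then have "(D \<longlongrightarrow> exp c) strip_end"
    by simp
  then have "((\<lambda>z. D (strip_of_disc z)) \<longlongrightarrow> exp c) (at 1 within unit_disc)"
    using filterlim_strip_of_disc by (rule filterlim_compose)
  then have "(deriv (\<lambda>z. disc_of_strip (f (strip_of_disc z))) \<longlongrightarrow> exp c) (at 1 within unit_disc)"
  proof (rule tendsto_within_cong)
    show "deriv (\<lambda>z. disc_of_strip (f (strip_of_disc z))) z = D (strip_of_disc z)"
      if z: "z \<in> unit_disc" for z
      unfolding D_def using strip_of_disc_in[OF z]
      by (intro DERIV_imp_deriv DERIV_strip_conjugate z in_strip deriv)
  qed
  then show "nontangential_limit (deriv (\<lambda>z. disc_of_strip (f (strip_of_disc z)))) 1 (exp c)"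
    by (rule nontangential_limitI)
qed

subsection \<open>The semigroup\<close>

definition disc_flow :: "real \<Rightarrow> complex \<Rightarrow> complex"
  where "disc_flow t z = disc_of_strip (strip_flow t (strip_of_disc z))"

lemma holomorphic_semigroup_disc_flow: "holomorphic_semigroup disc_flow"
  unfolding disc_flow_def[abs_def]
proof (rule holomorphic_semigroup_strip)
  show "strip_flow t holomorphic_on strip" if "0 \<le> t" for t
    using DERIV_strip_flow[OF _ that] by (auto simp: holomorphic_on_open[OF open_strip])
qed (simp_all add: strip_flow_in strip_flow_0 strip_flow_add norm_strip_flow_diff_le)

lemma repelling_fixed_point_disc_flow: "repelling_fixed_point disc_flow 1 (- 1)"
proof -
  have "nontangential_limit (disc_flow t) 1 1 \<and> nontangential_limit (deriv (disc_flow t)) 1 (exp (of_real t))"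
    if t: "0 \<le> t" for t
  proof -
    have "((\<lambda>w. koenigs' w / koenigs' (strip_flow t w)) \<longlongrightarrow> 1 / 1) strip_end"
      by (intro tendsto_intros tendsto_koenigs' filterlim_compose[OF tendsto_koenigs' filterlim_strip_flow[OF t]]) simp
    then show ?thesis
      unfolding disc_flow_def[abs_def]
      using strip_conjugate_limits[OF strip_flow_in[OF _ t] DERIV_strip_flow[OF _ t]
          filterlim_strip_flow[OF t] tendsto_strip_flow_diff[OF t]] by simp
  qed
  then show ?thesis
    by (simp add: repelling_fixed_point_def exp_of_real)
qed

text \<open>If some \<open>disc_flow t\<close> with \<open>t > 0\<close> were surjective, the domain would be invariant under
  translation to the left as well. But all its points far to the left are close to \<open>strip\<close>,
  whereas it contains points outside \<open>strip\<close>.\<close>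

lemma not_holomorphic_group_disc_flow: "\<not> holomorphic_group disc_flow"
proof
  assume "holomorphic_group disc_flow"
  then obtain t where t: "0 < t" and surj: "disc_flow t ` unit_disc = unit_disc"
    by (auto simp: holomorphic_group_def disc_automorphism_def bij_betw_def)
  have step: "y - of_real t \<in> koenigs_domain" if y: "y \<in> koenigs_domain" for y
  proof -
    obtain w where w: "w \<in> strip" "y = koenigs w"
      using y by (auto simp: koenigs_domain_def)
    then obtain z where z: "z \<in> unit_disc" "disc_flow t z = disc_of_strip w"
      using surj disc_of_strip_in[OF w(1)] by (metis imageE)
    have z': "strip_of_disc z \<in> strip"
      using strip_of_disc_in z(1) by blast
    have "strip_flow t (strip_of_disc z) = w"
      using arg_cong[OF z(2), of strip_of_disc] w(1) t z' strip_flow_in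
      by (simp add: disc_flow_def)
    then have "y - of_real t = koenigs (strip_of_disc z)"
      using koenigs_strip_flow[OF z', of t] t w(2) by simp
    then show ?thesis
      using z' koenigs_in_domain by simp
  qed
  obtain y where y: "y \<in> koenigs_domain" "pi / 2 < Im y"
    by (rule exists_koenigs_domain_not_strip)
  have iter: "y - of_real (real n * t) \<in> koenigs_domain" for n
  proof (induction n)
    case (Suc n)
    from step[OF this] show ?case
      by (simp add: algebra_simps)
  qed (use y in simp)
  define \<epsilon> where "\<epsilon> = Im y - pi / 2"
  have "0 < \<epsilon>"
    using y by (simp add: \<epsilon>_def)
  \<comment> \<open>The choice makes \<open>Re w\<close> smaller than
    \<open>- pi / (2 * \<epsilon>)\<close>; \<open>pi / \<epsilon>\<close> compensates for the
    factor 2 in \<open>Re_koenigs_ge\<close>.\<close>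
  obtain n where n: "Re y + pi / \<epsilon> < real n * t"
    using t reals_Archimedean3 by blast
  obtain w where w: "w \<in> strip" "koenigs w = y - of_real (real n * t)"
    using iter[of n] by (auto simp: koenigs_domain_def)
  then have w': "w \<in> closed_strip"
    using strip_subset_closed_strip by blast
  have "2 * Re w \<le> Re y - real n * t"
    using Re_koenigs_ge[OF w'] w(2) by simp
  then have Re_w: "pi / 2 / \<epsilon> < - Re w"
    using n by simp
  moreover have "0 < pi / 2 / \<epsilon>"
    using \<open>0 < \<epsilon>\<close> by simp
  ultimately have "Re w < 0"
    by linarith
  \<comment> \<open>The shift is real, so \<open>koenigs w\<close> still has the height of
    \<open>y\<close>, while \<open>w\<close> lies below \<open>pi / 2\<close>.\<close>
  have "Im y - Im w \<le> pi / 2 / (- Re w)"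
    using abs_Im_koenigs_diff_le[OF w' \<open>Re w < 0\<close>] w(2) by simp
  also have "\<dots> < \<epsilon>"
    using Re_w \<open>0 < \<epsilon>\<close> \<open>Re w < 0\<close> by (simp add: field_simps)
  finally show False
    using w(1) by (simp add: \<epsilon>_def strip_def)
qed

subsection \<open>The hyperbolic group\<close>

definition disc_translation :: "real \<Rightarrow> complex \<Rightarrow> complex"
  where "disc_translation t z = disc_of_strip (strip_of_disc z + of_real t)"

lemma disc_translation_conv:
  assumes "z \<in> unit_disc"
  shows "disc_translation t z =
    ((1 + z) - of_real (exp t) * (1 - z)) / ((1 + z) + of_real (exp t) * (1 - z))"
proof -
  have "1 + z \<noteq> 0"
    using assms by (auto simp: add_eq_0_iff)
  then show ?thesis
    by (simp add: disc_translation_def disc_of_strip_def exp_add exp_strip_of_disc[OF assms] exp_of_real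
        divide_simps mult.commute)
qed

lemma disc_translation_limits:
  shows "nontangential_limit (disc_translation t) 1 1"
    and "nontangential_limit (deriv (disc_translation t)) 1 (of_real (exp t))"
    and "nontangential_limit (disc_translation t) (- 1) (- 1)"
    and "nontangential_limit (deriv (disc_translation t)) (- 1) (of_real (exp (- t)))"
proof -
  have "filterlim (\<lambda>w. w + of_real t) strip_end strip_end"
    unfolding filterlim_strip_end filterlim_at_bot_dense
    by (simp add: eventually_Re_less_strip_end eventually_in_strip_end flip: less_diff_eq)
  moreover have "((\<lambda>w. w + of_real t) has_field_derivative 1) (at w)" for w :: complex
    by (auto intro!: derivative_eq_intros)
  ultimately show "nontangential_limit (disc_translation t) 1 1"
    "nontangential_limit (deriv (disc_translation t)) 1 (of_real (exp t))"
    using strip_conjugate_limits[of "\<lambda>w. w + of_real t" "\<lambda>_. 1" "of_real t"]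
    by (simp_all add: disc_translation_def[abs_def] exp_of_real)
  \<comment> \<open>The point -1 belongs to the right end of the strip. There the explicit Moebius
    form is continuous, with denominator \<open>2 * a\<close>, so the limits are values of
    \<open>m\<close> and \<open>m'\<close>.\<close>
  define a where "a = complex_of_real (exp t)"
  define m where "m z = ((1 + z) - a * (1 - z)) / ((1 + z) + a * (1 - z))" for z
  define m' where "m' z = 4 * a / ((1 + z) + a * (1 - z))\<^sup>2" for z
  have "a \<noteq> 0"
    by (simp add: a_def)
  have nz: "(1 + z) + a * (1 - z) \<noteq> 0" if z: "z \<in> unit_disc" for z
  proof -
    have "1 + z \<noteq> 0"
      using z by (auto simp: add_eq_0_iff)
    moreover from this have "(1 + z) + a * (1 - z) = (1 + z) * (1 + a * ((1 - z) / (1 + z)))"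
      by (simp add: field_simps)
    moreover have "0 < Re (a * ((1 - z) / (1 + z)))"
      using Re_cayley_pos[OF z]
      by (simp only: a_def times_complex.sel Re_complex_of_real Im_complex_of_real) simp
    then have "1 + a * ((1 - z) / (1 + z)) \<noteq> 0"
      by (intro norm_1_plus_ge(4)) simp
    ultimately show ?thesis
      by simp
  qed
  have eq: "disc_translation t z = m z" if "z \<in> unit_disc" for z
    using disc_translation_conv[OF that] by (simp add: m_def a_def)
  have deriv_eq: "deriv (disc_translation t) z = m' z" if z: "z \<in> unit_disc" for z
  proof (rule DERIV_imp_deriv)
    have "(m has_field_derivative m' z) (at z)"
      unfolding m_def[abs_def] m'_def using nz[OF z]
      by (auto intro!: derivative_eq_intros simp: power2_eq_square algebra_simps)
    then show "(disc_translation t has_field_derivative m' z) (at z)"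
      using eq by (auto intro: has_field_derivative_transform_within_open[OF _ open_ball z])
  qed
  have "(m \<longlongrightarrow> m (- 1)) (at (- 1) within unit_disc)" "(m' \<longlongrightarrow> m' (- 1)) (at (- 1) within unit_disc)"
    unfolding m_def[abs_def] m'_def[abs_def] using \<open>a \<noteq> 0\<close> by (auto intro!: tendsto_eq_intros)
  moreover have "m (- 1) = - 1" "m' (- 1) = of_real (exp (- t))"
    using \<open>a \<noteq> 0\<close> by (simp_all add: m_def m'_def a_def exp_minus power2_eq_square divide_simps)
  ultimately have "(disc_translation t \<longlongrightarrow> - 1) (at (- 1) within unit_disc)"
    "(deriv (disc_translation t) \<longlongrightarrow> of_real (exp (- t))) (at (- 1) within unit_disc)"
    using eq deriv_eq by (auto intro: tendsto_within_cong)
  then show "nontangential_limit (disc_translation t) (- 1) (- 1)"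
    "nontangential_limit (deriv (disc_translation t)) (- 1) (of_real (exp (- t)))"
    by (auto intro: nontangential_limitI)
qed

text \<open>The distance to -1 is \<open>2 / cmod (1 + exp w)\<close>. Translation by
  \<open>t\<close> multiplies \<open>exp w\<close> by \<open>exp t\<close>, and on a compact set its
  initial real part has a positive minimum.\<close>

lemma uniform_limit_disc_translation:
  assumes "compact K" "K \<subseteq> unit_disc"
  shows "uniform_limit K disc_translation (\<lambda>_. - 1) at_top"
proof (cases "K = {}")
  case False
  have "continuous_on K (\<lambda>z. Re ((1 - z) / (1 + z)))"
    using assms(2) by (intro continuous_intros) (auto simp: add_eq_0_iff)
  then obtain z0 where z0: "z0 \<in> K"
    and min: "\<And>z. z \<in> K \<Longrightarrow> Re ((1 - z0) / (1 + z0)) \<le> Re ((1 - z) / (1 + z))"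
    using continuous_attains_inf[OF assms(1) False] by blast
  define m where "m = Re ((1 - z0) / (1 + z0))"
  have "0 < m"
    unfolding m_def using z0 assms(2) by (intro Re_cayley_pos) blast
  have bound: "dist (disc_translation t z) (- 1) \<le> 2 / (exp t * m)" if z: "z \<in> K" for t z
  proof -
    have z': "z \<in> unit_disc"
      using z assms(2) by blast
    define w where "w = strip_of_disc z + of_real t"
    have "w \<in> strip"
      using strip_of_disc_in[OF z'] by (simp add: w_def)
    then have "disc_translation t z - (- 1) = 2 / (1 + exp w)"
      using one_plus_exp_neq_0 by (simp add: disc_translation_def disc_of_strip_def w_def[symmetric] divide_simps)
    moreover have "exp t * m \<le> Re (exp w)"
    proof -
      have "exp w = of_real (exp t) * ((1 - z) / (1 + z))"
        by (simp add: w_def exp_add exp_strip_of_disc[OF z'] exp_of_real)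
      then have "Re (exp w) = exp t * Re ((1 - z) / (1 + z))"
        by (simp only: times_complex.sel Re_complex_of_real Im_complex_of_real mult_zero_left diff_zero)
      then show ?thesis
        using min[OF z] by (simp add: m_def)
    qed
    then have "exp t * m \<le> cmod (1 + exp w)"
      using complex_Re_le_cmod[of "1 + exp w"] by simp
    ultimately show ?thesis
      using \<open>0 < m\<close> by (simp add: dist_norm norm_divide frac_le)
  qed
  have "((\<lambda>t. 2 / (exp t * m)) \<longlongrightarrow> 0) at_top"
    using \<open>0 < m\<close> by (intro tendsto_divide_0[OF tendsto_const] filterlim_at_top_imp_at_infinity
        filterlim_at_top_mult_tendsto_pos[OF tendsto_const _ exp_at_top])
  show ?thesis
  proof (rule uniform_limitI)
    fix e :: real assume "0 < e"
    then have "\<forall>\<^sub>F t in at_top. 2 / (exp t * m) < e"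
      using \<open>((\<lambda>t. 2 / (exp t * m)) \<longlongrightarrow> 0) at_top\<close> order_tendstoD(2) by blast
    then show "\<forall>\<^sub>F t in at_top. \<forall>z\<in>K. dist (disc_translation t z) (- 1) < e"
      by (rule eventually_mono) (use bound in \<open>blast intro: order_le_less_trans\<close>)
  qed
qed simp

lemma hyperbolic_group_disc_translation: "hyperbolic_group disc_translation (- 1) 1 1"
proof -
  have semigroup: "holomorphic_semigroup disc_translation"
    unfolding disc_translation_def[abs_def]
    by (rule holomorphic_semigroup_strip) (auto intro!: holomorphic_intros simp flip: of_real_diff)
  have inverse: "disc_translation (- t) (disc_translation t z) = z"
    and in_disc: "disc_translation t z \<in> unit_disc" if "z \<in> unit_disc" for t z
    using strip_of_disc_in[OF that] that disc_of_strip_in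
    by (simp_all only: disc_translation_def add_of_real_mem_strip strip_of_disc_of_strip) simp
  have "bij_betw (disc_translation t) unit_disc unit_disc" for t
    using inverse inverse[of _ "- t"] in_disc
    by (intro bij_betw_byWitness[where f' = "disc_translation (- t)"]) auto
  then have "disc_automorphism (disc_translation t)" if "0 \<le> t" for t
    using semigroup that by (simp add: disc_automorphism_def holomorphic_semigroup_def)
  with semigroup show ?thesis
    using disc_translation_limits uniform_limit_disc_translation
    by (simp add: hyperbolic_group_def)
qed

subsection \<open>The pre-model\<close>

text \<open>The inverse Koenigs function can be applied here because the domain contains the
  strip.\<close>

definition intertwiner :: "complex \<Rightarrow> complex"
  where "intertwiner z = disc_of_strip (koenigs_inv (strip_of_disc z))"

lemma koenigs_inv_strip_of_disc_in:
  assumes "z \<in> unit_disc"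
  shows "koenigs_inv (strip_of_disc z) \<in> strip"
    and "koenigs (koenigs_inv (strip_of_disc z)) = strip_of_disc z"
  using koenigs_inv_in koenigs_koenigs_inv strip_of_disc_in[OF assms] strip_subset_koenigs_domain
  by auto

lemma intertwiner_in: "z \<in> unit_disc \<Longrightarrow> intertwiner z \<in> unit_disc"
  unfolding intertwiner_def by (intro disc_of_strip_in koenigs_inv_strip_of_disc_in)

lemma holomorphic_intertwiner: "intertwiner holomorphic_on unit_disc"
proof -
  have "(koenigs_inv \<circ> strip_of_disc) holomorphic_on unit_disc"
    using strip_of_disc_in strip_subset_koenigs_domain
    by (intro holomorphic_on_compose_gen[OF holomorphic_strip_of_disc holomorphic_koenigs_inv]) blast
  then have "(disc_of_strip \<circ> (koenigs_inv \<circ> strip_of_disc)) holomorphic_on unit_disc"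
    using koenigs_inv_strip_of_disc_in
    by (intro holomorphic_on_compose_gen[OF _ holomorphic_disc_of_strip]) auto
  then show ?thesis
    by (simp add: intertwiner_def[abs_def] o_def)
qed

lemma inj_on_intertwiner: "inj_on intertwiner unit_disc"
proof (rule inj_on_inverseI)
  show "disc_of_strip (koenigs (strip_of_disc (intertwiner z))) = z" if "z \<in> unit_disc" for z
    using koenigs_inv_strip_of_disc_in[OF that] that
    by (simp only: intertwiner_def strip_of_disc_of_strip disc_of_strip_of_disc)
qed

text \<open>Both sides reduce to \<open>koenigs_inv\<close> applied to
  \<open>strip_of_disc z + t\<close>: the flow is translation in the Koenigs coordinate.\<close>

lemma intertwiner_disc_translation:
  assumes "0 \<le> t" "z \<in> unit_disc"
  shows "intertwiner (disc_translation t z) = disc_flow t (intertwiner z)"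
  using koenigs_inv_strip_of_disc_in[OF assms(2)] strip_of_disc_in[OF assms(2)]
  by (simp only: intertwiner_def disc_flow_def disc_translation_def strip_flow_def
      add_of_real_mem_strip strip_of_disc_of_strip)

lemma tendsto_intertwiner: "(intertwiner \<longlongrightarrow> 1) (at 1 within unit_disc)"
  unfolding intertwiner_def[abs_def]
  by (intro filterlim_compose[OF tendsto_disc_of_strip] filterlim_compose[OF filterlim_koenigs_inv]
      filterlim_strip_of_disc)

text \<open>The second factor tends to 1. The argument of the first one decides semi-conformality
  and its modulus decides regularity.\<close>

lemma intertwiner_quotient:
  fixes z :: complex
  assumes "z \<in> unit_disc"
  defines "u \<equiv> koenigs_inv (strip_of_disc z)"
  shows "(1 - intertwiner z) / (1 - z) =
    exp (u - koenigs u) * ((1 + exp (strip_of_disc z)) / (1 + exp u))"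
proof -
  define w where "w = strip_of_disc z"
  have w: "w \<in> strip" "u \<in> strip" "koenigs u = w"
    using koenigs_inv_strip_of_disc_in[OF assms(1)] strip_of_disc_in[OF assms(1)]
    by (simp_all add: w_def u_def)
  have "(1 - intertwiner z) / (1 - z) = (1 - disc_of_strip u) / (1 - disc_of_strip w)"
    using assms(1) by (simp add: intertwiner_def u_def w_def)
  also have "\<dots> = exp (u - w) * ((1 + exp w) / (1 + exp u))"
    using w one_plus_exp_neq_0 by (simp add: one_minus_disc_of_strip exp_diff divide_simps)
  finally show ?thesis
    using w by (simp add: w_def)
qed

lemma filterlim_koenigs_inv_strip_of_disc:
  "filterlim (\<lambda>z. koenigs_inv (strip_of_disc z)) strip_end (at 1 within unit_disc)"
  by (rule filterlim_compose[OF filterlim_koenigs_inv filterlim_strip_of_disc])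

lemma tendsto_one_plus_exp_quotient:
  "((\<lambda>z. (1 + exp (strip_of_disc z)) / (1 + exp (koenigs_inv (strip_of_disc z)))) \<longlongrightarrow> 1)
    (at 1 within unit_disc)"
proof -
  have "((\<lambda>z. (1 + exp (strip_of_disc z)) / (1 + exp (koenigs_inv (strip_of_disc z)))) \<longlongrightarrow>
      (1 + 0) / (1 + 0)) (at 1 within unit_disc)"
    by (intro tendsto_intros filterlim_compose[OF tendsto_exp_strip_end] filterlim_strip_of_disc
        filterlim_koenigs_inv_strip_of_disc) simp
  then show ?thesis
    by simp
qed

lemma semiconformal_at_intertwiner: "semiconformal_at intertwiner 1"
proof -
  define u where "u z = koenigs_inv (strip_of_disc z)" for z
  define r where "r z = (1 + exp (strip_of_disc z)) / (1 + exp (u z))" for z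
  \<comment> \<open>Up to a positive real factor \<open>x\<close> is the quotient of
    \<open>intertwiner_quotient\<close>, so it has the same argument; unlike the quotient, it
    converges.\<close>
  define x where "x z = exp (\<i> * of_real (- Im (koenigs (u z) - u z))) * r z" for z
  have "(x \<longlongrightarrow> exp (\<i> * of_real (- 0)) * 1) (at 1 within unit_disc)"
    unfolding x_def r_def u_def
    by (intro tendsto_intros tendsto_one_plus_exp_quotient
        filterlim_compose[OF tendsto_Im_koenigs_diff filterlim_koenigs_inv_strip_of_disc])
  then have "(x \<longlongrightarrow> 1) (at 1 within unit_disc)"
    by simp
  then have "((\<lambda>z. Arg (x z)) \<longlongrightarrow> Arg 1) (at 1 within unit_disc)"
    by (rule isCont_tendsto_compose[rotated]) (simp add: continuous_at_Arg)
  moreover have "Arg ((1 - cnj 1 * intertwiner z) / (1 - cnj 1 * z)) = Arg (x z)"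
    if z: "z \<in> unit_disc" for z
  proof -
    define v where "v = u z - koenigs (u z)"
    have "exp v = of_real (exp (Re v)) * exp (\<i> * of_real (Im v))"
      by (metis complex_eq exp_add exp_of_real)
    then have "(1 - cnj 1 * intertwiner z) / (1 - cnj 1 * z) = of_real (exp (Re v)) * x z"
      using intertwiner_quotient[OF z] by (simp add: x_def r_def v_def u_def)
    then show ?thesis
      by (simp only: Arg_times_of_real exp_gt_zero)
  qed
  ultimately have "((\<lambda>z. Arg ((1 - cnj 1 * intertwiner z) / (1 - cnj 1 * z))) \<longlongrightarrow> Arg 1)
      (at 1 within unit_disc)"
    by (rule tendsto_within_cong)
  then show ?thesis
    unfolding semiconformal_at_def by (intro nontangential_limitI) simp
qed

lemma pre_model_intertwiner: "pre_model disc_flow 1 (- 1) intertwiner disc_translation"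
  unfolding pre_model_def
  using hyperbolic_group_disc_translation holomorphic_intertwiner intertwiner_in inj_on_intertwiner
    nontangential_limitI[OF tendsto_intertwiner] semiconformal_at_intertwiner
    intertwiner_disc_translation
  by auto

section \<open>Failure of regularity\<close>

lemma filterlim_exp_koenigs_diff: "filterlim (\<lambda>u. cmod (exp (u - koenigs u))) at_top strip_end"
proof (rule filterlim_at_top_mono[OF filterlim_minus_Re_strip_end])
  show "\<forall>\<^sub>F u in strip_end. - Re u \<le> cmod (exp (u - koenigs u))"
  proof (rule eventually_mono[OF eventually_in_strip_end])
    fix u assume "u \<in> strip"
    then have u: "u \<in> closed_strip"
      using strip_subset_closed_strip by blast
    have "Ln (1 + exp (- u)) \<noteq> 0"
      using Re_Ln_1_plus_exp_pos[OF u] by force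
    \<comment> \<open>Exponentiation undoes the outer logarithm of \<open>koenigs\<close>; the inner
      one remains, with real part at least \<open>- Re u\<close>.\<close>
    then have "exp (u - koenigs u) = Ln (1 + exp (- u))"
      by (simp add: koenigs_def)
    then show "- Re u \<le> cmod (exp (u - koenigs u))"
      using Re_Ln_1_plus_exp_ge[OF u] complex_Re_le_cmod order_trans by metis
  qed
qed

lemma filterlim_intertwiner_quotient:
  "filterlim (\<lambda>z. (1 - intertwiner z) / (1 - z)) at_infinity (at 1 within unit_disc)"
proof -
  have "filterlim (\<lambda>z. cmod (exp (koenigs_inv (strip_of_disc z) - koenigs (koenigs_inv (strip_of_disc z)))) *
      cmod ((1 + exp (strip_of_disc z)) / (1 + exp (koenigs_inv (strip_of_disc z)))))
      at_top (at 1 within unit_disc)"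
    by (rule filterlim_at_top_mult_tendsto_pos[OF tendsto_norm[OF tendsto_one_plus_exp_quotient] _
          filterlim_compose[OF filterlim_exp_koenigs_diff filterlim_koenigs_inv_strip_of_disc]]) simp
  moreover have "eventually (\<lambda>z.
      cmod (exp (koenigs_inv (strip_of_disc z) - koenigs (koenigs_inv (strip_of_disc z)))) *
      cmod ((1 + exp (strip_of_disc z)) / (1 + exp (koenigs_inv (strip_of_disc z)))) =
      cmod ((1 - intertwiner z) / (1 - z))) (at 1 within unit_disc)"
    by (rule eventually_mono[OF eventually_at_within_in])
      (simp only: intertwiner_quotient norm_mult)
  ultimately have "filterlim (\<lambda>z. cmod ((1 - intertwiner z) / (1 - z))) at_top (at 1 within unit_disc)"
    by (rule filterlim_cong[OF refl refl, THEN iffD1, rotated])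
  then show ?thesis
    by (rule filterlim_norm_at_top_imp_at_infinity)
qed

text \<open>A finite and an infinite limit contradict each other only along a nontrivial filter. The
  radial points \<open>1 - d\<close> lie in the region because \<open>d < 2 * d\<close>.\<close>

lemma stolz_region_nontrivial: "at 1 within stolz_region 1 2 \<noteq> bot"
proof -
  have "\<exists>x\<in>stolz_region 1 2. x \<noteq> 1 \<and> dist x 1 < e" if "0 < e" for e
  proof
    define d where "d = min (e / 2) (1 / 2)"
    have d: "0 < d" "d < e" "d \<le> 1 / 2"
      using that by (auto simp: d_def)
    have "cmod (1 - of_real d) = \<bar>1 - d\<bar>"
      by (metis norm_of_real of_real_1 of_real_diff)
    then show "1 - of_real d \<in> stolz_region 1 2"
      using d by (simp add: stolz_region_def)
    show "1 - of_real d \<noteq> (1 :: complex) \<and> dist (1 - of_real d) (1 :: complex) < e"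
      using d by (simp add: dist_norm)
  qed
  then show ?thesis
    by (simp add: trivial_limit_within islimpt_approachable)
qed

lemma not_regular_at_intertwiner: "\<not> regular_at intertwiner 1"
proof
  assume "regular_at intertwiner 1"
  then obtain L where "nontangential_limit (\<lambda>z. (1 - intertwiner z) / (1 - z)) 1 L"
    by (auto simp: regular_at_def)
  then have L: "((\<lambda>z. (1 - intertwiner z) / (1 - z)) \<longlongrightarrow> L) (at 1 within stolz_region 1 2)"
    by (simp add: nontangential_limit_def)
  have "filterlim (\<lambda>z. (1 - intertwiner z) / (1 - z)) at_infinity (at 1 within stolz_region 1 2)"
    by (rule filterlim_mono[OF filterlim_intertwiner_quotient order_refl at_le])
      (auto simp: stolz_region_def)
  with L show False
    using not_tendsto_and_filterlim_at_infinity[OF stolz_region_nontrivial] by blast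
qed

theorem mainTheorem8:
  shows "\<exists>(\<phi> :: real \<Rightarrow> complex \<Rightarrow> complex) (\<sigma> :: complex) (lam :: real)
           (g :: complex \<Rightarrow> complex) (\<eta> :: real \<Rightarrow> complex \<Rightarrow> complex).
           holomorphic_semigroup \<phi> \<and> \<not> holomorphic_group \<phi> \<and>
           repelling_fixed_point \<phi> \<sigma> lam \<and>
           pre_model \<phi> \<sigma> lam g \<eta> \<and>
           \<not> regular_at g \<sigma>"
  using holomorphic_semigroup_disc_flow not_holomorphic_group_disc_flow
    repelling_fixed_point_disc_flow pre_model_intertwiner not_regular_at_intertwiner
  by blast

end
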